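(* Let $\Omega\subset\mathbb C$ be a connected open set and let $T=\begin{pmatrix}T_0&S\\0&T_1\end{pmatrix}$ be an operator in $\mathcal FB_2(\Omega)$, written in a decomposition as in the definition of $\mathcal FB_2(\Omega)$. Then $T$ is irreducible. If moreover $S$ is invertible, then $T$ is strongly irreducible.
   Context: Hilbert spaces are complex and separable. For a connected open set $\Omega\subset\mathbb C$ and $n\ge 1$, the Cowen-Douglas class $B_n(\Omega)$ consists of the bounded linear operators $T$ on a Hilbert space $\mathcal H$ such that for every $w\in\Omega$: $\dim\ker(T-w)=n$, $\operatorname{ran}(T-w)=\mathcal H$, and such that the closed linear span of $\bigcup_{w\in\Omega}\ker(T-w)$ is $\mathcal H$. $\mathcal FB_2(\Omega)$ is the set of operators $T\in B_2(\Omega)$ which admit, with respect to some orthogonal decomposition $\mathcal H=\mathcal H_0\oplus\mathcal H_1$, a decomposition $T=\begin{pmatrix}T_0&S\\0&T_1\end{pmatrix}$ with $T_0,T_1\in B_1(\Omega)$ and $S:\mathcal H_1\to\mathcal H_0$ a non-zero bounded operator satisfying $T_0S=ST_1$. An operator is irreducible if it has no non-trivial reducing subspace (equivalently, the only orthogonal projections commuting with it are $0$ and $I$). It is strongly irreducible if the only bounded idempotents commuting with it are $0$ and $I$. *)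

theory Defs
  imports "HOL-Analysis.Analysis"
begin

(* Complex Hilbert spaces are built on top of the real ones, so that norm, topology and
   completeness are those of the library. cinner is linear in its first argument; positive
   definiteness and norm x ^ 2 = cinner x x come from Re (cinner x y) = inner x y. *)
class complex_inner = real_inner +
  fixes scaleC :: "complex \<Rightarrow> 'a \<Rightarrow> 'a" (infixr "*\<^sub>C" 75)
    and cinner :: "'a \<Rightarrow> 'a \<Rightarrow> complex"
  assumes scaleC_add_right: "c *\<^sub>C (x + y) = c *\<^sub>C x + c *\<^sub>C y"
    and scaleC_add_left: "(c + d) *\<^sub>C x = c *\<^sub>C x + d *\<^sub>C x"
    and scaleC_scaleC: "c *\<^sub>C d *\<^sub>C x = (c * d) *\<^sub>C x"
    and scaleC_of_real: "complex_of_real r *\<^sub>C x = r *\<^sub>R x"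
    and cinner_commute: "cinner x y = cnj (cinner y x)"
    and cinner_add_left: "cinner (x + y) z = cinner x z + cinner y z"
    and cinner_scaleC_left: "cinner (c *\<^sub>C x) y = c * cinner x y"
    and Re_cinner: "Re (cinner x y) = inner x y"

(* second_countable_topology is separability *)
class complex_hilbert = complex_inner + banach + second_countable_topology

instantiation complex :: complex_hilbert
begin

definition scaleC_complex :: "complex \<Rightarrow> complex \<Rightarrow> complex" where
  "scaleC_complex c x = c * x"

definition cinner_complex :: "complex \<Rightarrow> complex \<Rightarrow> complex" where
  "cinner_complex x y = x * cnj y"

instance
  by standard
    (auto simp: scaleC_complex_def cinner_complex_def inner_complex_def algebra_simps
      scaleR_conv_of_real)

end

global_interpretation complex_vector: vector_space "scaleC :: complex \<Rightarrow> 'a \<Rightarrow> 'a::complex_inner"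
  defines csubspace = complex_vector.subspace
    and cspan = complex_vector.span
    and cdim = complex_vector.dim
proof
  show "1 *\<^sub>C x = x" for x :: 'a
    using scaleC_of_real[of 1 x] by simp
qed (simp_all add: scaleC_add_right scaleC_add_left scaleC_scaleC)

definition closed_csubspace :: "'a::complex_inner set \<Rightarrow> bool" where
  "closed_csubspace V \<longleftrightarrow> csubspace V \<and> closed V"

(* Hilbert spaces occurring as summands are closed subspaces V of the ambient type. An operator
   between two of them is a function on the ambient type whose values outside its domain are
   irrelevant. *)
definition bounded_operator ::
  "'a::complex_inner set \<Rightarrow> 'b::complex_inner set \<Rightarrow> ('a \<Rightarrow> 'b) \<Rightarrow> bool" where
  "bounded_operator V W A \<longleftrightarrow>
     (\<forall>x\<in>V. A x \<in> W) \<and>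
     (\<forall>x\<in>V. \<forall>y\<in>V. A (x + y) = A x + A y) \<and>
     (\<forall>c. \<forall>x\<in>V. A (c *\<^sub>C x) = c *\<^sub>C A x) \<and>
     (\<exists>K. \<forall>x\<in>V. norm (A x) \<le> K * norm x)"

definition invertible_operator ::
  "'a::complex_inner set \<Rightarrow> 'b::complex_inner set \<Rightarrow> ('a \<Rightarrow> 'b) \<Rightarrow> bool" where
  "invertible_operator V W A \<longleftrightarrow> bounded_operator V W A \<and>
     (\<exists>B. bounded_operator W V B \<and> (\<forall>x\<in>V. B (A x) = x) \<and> (\<forall>y\<in>W. A (B y) = y))"

definition kernel_minus :: "'a::complex_inner set \<Rightarrow> ('a \<Rightarrow> 'a) \<Rightarrow> complex \<Rightarrow> 'a set" where
  "kernel_minus V T w = {x \<in> V. T x - w *\<^sub>C x = 0}"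

(* The class B_n(Omega) on the Hilbert space V. The library dimension of an infinite-dimensional
   space is 0, so cdim _ = n with n \<ge> 1 includes finite-dimensionality. *)
definition cowen_douglas ::
  "nat \<Rightarrow> complex set \<Rightarrow> 'a::complex_hilbert set \<Rightarrow> ('a \<Rightarrow> 'a) set" where
  "cowen_douglas n \<Omega> V =
     {T. n \<ge> 1 \<and> closed_csubspace V \<and> bounded_operator V V T \<and>
         (\<forall>w\<in>\<Omega>. cdim (kernel_minus V T w) = n \<and> (\<lambda>x. T x - w *\<^sub>C x) ` V = V) \<and>
         closure (cspan (\<Union>w\<in>\<Omega>. kernel_minus V T w)) = V}"

definition orthogonal_decomposition :: "'a::complex_inner set \<Rightarrow> 'a set \<Rightarrow> bool" where
  "orthogonal_decomposition H0 H1 \<longleftrightarrow>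
     closed_csubspace H0 \<and> closed_csubspace H1 \<and>
     (\<forall>x\<in>H0. \<forall>y\<in>H1. cinner x y = 0) \<and>
     (\<forall>z. \<exists>x\<in>H0. \<exists>y\<in>H1. z = x + y)"

(* T = (T0 S; 0 T1) with respect to H0 + H1, as in the definition of FB_2(Omega) *)
definition FB2_decomposition ::
  "complex set \<Rightarrow> ('a::complex_hilbert \<Rightarrow> 'a) \<Rightarrow> 'a set \<Rightarrow> 'a set \<Rightarrow>
   ('a \<Rightarrow> 'a) \<Rightarrow> ('a \<Rightarrow> 'a) \<Rightarrow> ('a \<Rightarrow> 'a) \<Rightarrow> bool" where
  "FB2_decomposition \<Omega> T H0 H1 T0 S T1 \<longleftrightarrow>
     orthogonal_decomposition H0 H1 \<and>
     T0 \<in> cowen_douglas 1 \<Omega> H0 \<and> T1 \<in> cowen_douglas 1 \<Omega> H1 \<and>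
     bounded_operator H1 H0 S \<and> (\<exists>x\<in>H1. S x \<noteq> 0) \<and>
     (\<forall>x\<in>H1. T0 (S x) = S (T1 x)) \<and>
     (\<forall>x\<in>H0. \<forall>y\<in>H1. T (x + y) = (T0 x + S y) + T1 y)"

definition FB2 :: "complex set \<Rightarrow> ('a::complex_hilbert \<Rightarrow> 'a) set" where
  "FB2 \<Omega> = {T \<in> cowen_douglas 2 \<Omega> UNIV. \<exists>H0 H1 T0 S T1. FB2_decomposition \<Omega> T H0 H1 T0 S T1}"

definition ortho_complement :: "'a::complex_inner set \<Rightarrow> 'a set" where
  "ortho_complement M = {y. \<forall>x\<in>M. cinner x y = 0}"

definition reducing_subspace :: "('a::complex_inner \<Rightarrow> 'a) \<Rightarrow> 'a set \<Rightarrow> bool" where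
  "reducing_subspace T M \<longleftrightarrow>
     closed_csubspace M \<and> T ` M \<subseteq> M \<and> T ` ortho_complement M \<subseteq> ortho_complement M"

definition irreducible_operator :: "('a::complex_inner \<Rightarrow> 'a) \<Rightarrow> bool" where
  "irreducible_operator T \<longleftrightarrow> (\<forall>M. reducing_subspace T M \<longrightarrow> M = {0} \<or> M = UNIV)"

definition strongly_irreducible_operator :: "('a::complex_inner \<Rightarrow> 'a) \<Rightarrow> bool" where
  "strongly_irreducible_operator T \<longleftrightarrow>
     (\<forall>P. bounded_operator UNIV UNIV P \<and> P \<circ> P = P \<and> P \<circ> T = T \<circ> P \<longrightarrow>
          P = (\<lambda>x. 0) \<or> P = id)"

end

theory Submission
  imports Defs "HOL-Complex_Analysis.Conformal_Mappings"
begin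

text \<open>
  Write an operator commuting with T as a block matrix P = (P11 P12; P21 P22). Comparing blocks
  gives S P21 = P11 T0 - T0 P11, and S P21 commutes with T0; a commutator commuting with one of its
  entries is quasinilpotent (Kleinecke-Shirokov), so the scalars by which S P21 acts on the
  eigenlines of T0 vanish. Locally the eigenlines carry holomorphic sections, hence S is nonzero on
  the eigenlines of T1 over an open set, P21 vanishes on those of T0 over the same set, and
  P21 = 0 by the identity theorem. If P is idempotent, the same argument makes each of P11, P22
  equal to 0 or I.
  For a self-adjoint P also P12 = 0, and P11 S = S P22 with S nonzero forces P11 = P22. For a
  general idempotent and invertible S, the case P11 \<noteq> P22 would turn the identity into the
  commutator of T0 with a multiple of P12 inverse(S), contradicting the same quasinilpotence.
\<close>

subsection \<open>Complex inner product spaces and bounded operators\<close>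

text \<open>The left column of \<open>P T = T P\<close> has the lower entry
  \<open>P21 T0 = T1 P21\<close>; together with \<open>T0 S = S T1\<close> this is why
  \<open>S P21\<close> commutes with \<open>T0\<close>. The obstacle is that a nonzero
  \<open>S\<close> may still vanish on single eigenlines of \<open>T1\<close>, so
  \<open>S P21 = 0\<close> on an eigenline of \<open>T0\<close> does not by itself give
  \<open>P21 = 0\<close> there. Hence the restriction to an open set of good points, followed by
  analytic continuation. Only local sections are built; connectedness of \<Omega> replaces a global
  frame. Once \<open>P21 = 0\<close>, passing to diagonal blocks is multiplicative, and these blocks
  commute with \<open>T0\<close> and \<open>T1\<close>. The upper right entry,
  \<open>P11 S + P12 T1 = T0 P12 + S P22\<close>, is the source of both endings. If the idempotent
  diagonal blocks differ, it says that \<open>T0 P12 - P12 T1\<close> is \<open>S\<close> or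
  \<open>-S\<close>; multiplying on the right by the inverse of \<open>S\<close>, which carries
  \<open>T1\<close> to \<open>T0\<close>, yields a commutator with \<open>T0\<close>.\<close>

lemma scaleC_one [simp]: "1 *\<^sub>C x = x"
  using scaleC_of_real[of 1 x] by simp

lemma scaleC_zero_right [simp]: "c *\<^sub>C (0::'a::complex_inner) = 0"
  using scaleC_add_right[of c "0::'a" 0] by simp

lemma scaleC_minus_one: "(-1) *\<^sub>C x = - x"
  using scaleC_of_real[of "-1" x] by simp

lemma scaleC_diff_right: "c *\<^sub>C (x - y) = c *\<^sub>C x - c *\<^sub>C y"
  using scaleC_add_right[of c "x - y" y] by (simp add: algebra_simps)

lemma scaleC_eq_0_iff: "c *\<^sub>C x = 0 \<longleftrightarrow> c = 0 \<or> x = 0"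
proof -
  have "x = 0" if "c *\<^sub>C x = 0" "c \<noteq> 0"
  proof -
    have "x = inverse c *\<^sub>C c *\<^sub>C x"
      using that(2) by (simp add: scaleC_scaleC)
    then show ?thesis
      by (simp add: that(1))
  qed
  then show ?thesis
    by auto
qed

lemma cinner_add_right: "cinner x (y + z) = cinner x y + cinner x z"
  by (metis cinner_add_left cinner_commute complex_cnj_add)

lemma cinner_scaleC_right: "cinner x (c *\<^sub>C y) = cnj c * cinner x y"
  by (metis cinner_scaleC_left cinner_commute complex_cnj_mult)

lemma cinner_zero_left [simp]: "cinner 0 y = 0"
  using cinner_add_left[of 0 0 y] by simp

lemma cinner_zero_right [simp]: "cinner x 0 = 0"
  using cinner_add_right[of x 0 0] by simp

lemma cinner_minus_left: "cinner (- x) y = - cinner x y"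
  using cinner_add_left[of x "- x" y] by (simp add: eq_neg_iff_add_eq_0 add.commute)

lemma cinner_diff_left: "cinner (x - y) z = cinner x z - cinner y z"
  using cinner_add_left[of x "- y" z] by (simp add: cinner_minus_left)

lemma cinner_self_eq_0_iff: "cinner x x = 0 \<longleftrightarrow> x = 0"
  by (metis Re_cinner cinner_zero_left inner_eq_zero_iff zero_complex.simps(1))

lemma norm_scaleC: "norm (c *\<^sub>C x) = cmod c * norm x"
proof -
  have "cinner (c *\<^sub>C x) (c *\<^sub>C x) = of_real ((cmod c)\<^sup>2) * cinner x x"
    by (simp add: cinner_scaleC_left cinner_scaleC_right complex_norm_square del: of_real_power)
  then have "inner (c *\<^sub>C x) (c *\<^sub>C x) = (cmod c)\<^sup>2 * Re (cinner x x)"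
    by (metis Re_cinner times_complex.sel(1) Re_complex_of_real Im_complex_of_real mult_zero_left diff_zero)
  also have "\<dots> = (cmod c * norm x)\<^sup>2"
    by (simp add: Re_cinner power_mult_distrib power2_norm_eq_inner)
  finally show ?thesis
    by (metis norm_ge_zero mult_nonneg_nonneg power2_eq_imp_eq power2_norm_eq_inner)
qed

lemma cmod_cinner_le: "cmod (cinner x y) \<le> norm x * norm y"
proof (cases "cinner x y = 0")
  case False
  \<comment> \<open>A rotation by this unimodular factor makes the inner product real and
    nonnegative, so that the real Cauchy-Schwarz inequality suffices.\<close>
  define c where "c = cnj (sgn (cinner x y))"
  have c1: "cmod c = 1"
    using False by (simp add: c_def norm_sgn)
  have "c * cinner x y = (cinner x y * cnj (cinner x y)) / cmod (cinner x y)"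
    by (simp add: c_def sgn_eq)
  also have "\<dots> = cmod (cinner x y)"
    using False by (simp add: complex_norm_square[symmetric] power2_eq_square del: complex_cnj_mult)
  finally have c: "cinner (c *\<^sub>C x) y = cmod (cinner x y)"
    by (simp add: cinner_scaleC_left)
  have "cmod (cinner x y) = inner (c *\<^sub>C x) y"
    by (simp add: Re_cinner[symmetric] c)
  also have "\<dots> \<le> norm (c *\<^sub>C x) * norm y"
    by (rule norm_cauchy_schwarz)
  finally show ?thesis
    by (simp add: norm_scaleC c1)
qed simp

lemma csubspace_iff:
  "csubspace V \<longleftrightarrow> 0 \<in> V \<and> (\<forall>x\<in>V. \<forall>y\<in>V. x + y \<in> V) \<and> (\<forall>c. \<forall>x\<in>V. c *\<^sub>C x \<in> V)"
  by (simp add: complex_vector.subspace_def)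

lemma csubspace_0: "csubspace V \<Longrightarrow> 0 \<in> V"
  and csubspace_add: "csubspace V \<Longrightarrow> x \<in> V \<Longrightarrow> y \<in> V \<Longrightarrow> x + y \<in> V"
  and csubspace_scaleC: "csubspace V \<Longrightarrow> x \<in> V \<Longrightarrow> c *\<^sub>C x \<in> V"
  by (simp_all add: csubspace_iff)

lemma csubspace_diff: "csubspace V \<Longrightarrow> x \<in> V \<Longrightarrow> y \<in> V \<Longrightarrow> x - y \<in> V"
  by (rule complex_vector.subspace_diff)

lemma csubspace_sum: "csubspace V \<Longrightarrow> (\<And>i. i \<in> I \<Longrightarrow> f i \<in> V) \<Longrightarrow> sum f I \<in> V"
  by (rule complex_vector.subspace_sum)

lemma bounded_operator_in: "bounded_operator V W A \<Longrightarrow> x \<in> V \<Longrightarrow> A x \<in> W"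
  and bounded_operator_add:
    "bounded_operator V W A \<Longrightarrow> x \<in> V \<Longrightarrow> y \<in> V \<Longrightarrow> A (x + y) = A x + A y"
  and bounded_operator_scaleC: "bounded_operator V W A \<Longrightarrow> x \<in> V \<Longrightarrow> A (c *\<^sub>C x) = c *\<^sub>C A x"
  by (simp_all add: bounded_operator_def)

lemma bounded_operator_0: "bounded_operator V W A \<Longrightarrow> csubspace V \<Longrightarrow> A 0 = 0"
  using bounded_operator_scaleC[of V W A 0 0] by (simp add: csubspace_0)

lemma bounded_operator_diff:
  assumes "bounded_operator V W A" "csubspace V" "x \<in> V" "y \<in> V"
  shows "A (x - y) = A x - A y"
  using bounded_operator_add[OF assms(1), of "x - y" y] assms
  by (simp add: csubspace_diff)

lemma bounded_operator_bound:
  assumes "bounded_operator V W A"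
  obtains K where "K > 0" "\<And>x. x \<in> V \<Longrightarrow> norm (A x) \<le> K * norm x"
proof -
  obtain K where K: "\<forall>x\<in>V. norm (A x) \<le> K * norm x"
    using assms by (auto simp: bounded_operator_def)
  show thesis
  proof (rule that[of "max K 1"])
    show "norm (A x) \<le> max K 1 * norm x" if "x \<in> V" for x
      using K[rule_format, OF that] mult_right_mono[of K "max K 1" "norm x"] by simp
  qed simp
qed

lemma bounded_operator_sum:
  assumes "bounded_operator V W A" "csubspace V" "finite I" "\<And>i. i \<in> I \<Longrightarrow> f i \<in> V"
  shows "A (sum f I) = (\<Sum>i\<in>I. A (f i))"
  using assms(3,4)
  by (induction I rule: finite_induct)
     (simp_all add: bounded_operator_0[OF assms(1,2)] bounded_operator_add[OF assms(1)]
        csubspace_sum[OF assms(2)])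

lemma bounded_operator_sums:
  assumes A: "bounded_operator V W A" and V: "csubspace V"
    and f: "\<And>n. f n \<in> V" "f sums s" and s: "s \<in> V"
  shows "(\<lambda>n. A (f n)) sums A s"
proof -
  obtain K where K: "K > 0" "\<And>x. x \<in> V \<Longrightarrow> norm (A x) \<le> K * norm x"
    using bounded_operator_bound[OF A] by blast
  have le: "norm ((\<Sum>i<n. A (f i)) - A s) \<le> K * norm ((\<Sum>i<n. f i) - s)" for n
  proof -
    have "(\<Sum>i<n. f i) \<in> V"
      using V f(1) by (auto intro: csubspace_sum)
    then show ?thesis
      using K(2)[of "(\<Sum>i<n. f i) - s"] V f(1) s
      by (simp add: csubspace_diff bounded_operator_diff[OF A V] bounded_operator_sum[OF A V])
  qed
  have "(\<lambda>n. K * norm ((\<Sum>i<n. f i) - s)) \<longlonglongrightarrow> K * 0"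
    using f(2) unfolding sums_def by (rule tendsto_mult_left[OF tendsto_norm_zero[OF LIM_zero]])
  then have "(\<lambda>n. (\<Sum>i<n. A (f i)) - A s) \<longlonglongrightarrow> 0"
    using Lim_null_comparison[OF always_eventually[OF allI[OF le]]] by simp
  then show ?thesis
    unfolding sums_def by (rule LIM_zero_cancel)
qed

lemma bounded_operator_comp:
  assumes A: "bounded_operator V W A" and B: "bounded_operator U V B"
  shows "bounded_operator U W (\<lambda>x. A (B x))"
proof -
  obtain K where K: "K > 0" "\<And>x. x \<in> V \<Longrightarrow> norm (A x) \<le> K * norm x"
    using bounded_operator_bound[OF A] by blast
  obtain L where L: "L > 0" "\<And>x. x \<in> U \<Longrightarrow> norm (B x) \<le> L * norm x"
    using bounded_operator_bound[OF B] by blast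
  have "norm (A (B x)) \<le> (K * L) * norm x" if "x \<in> U" for x
    using K(2)[of "B x"] L(2)[OF that] bounded_operator_in[OF B that] K(1)
    by (metis mult.assoc mult_le_cancel_left_pos order_trans)
  moreover have "A (B x) \<in> W" "A (B (x + y)) = A (B x) + A (B y)" "A (B (c *\<^sub>C x)) = c *\<^sub>C A (B x)"
    if "x \<in> U" "y \<in> U" for x y c
    using that A B by (auto simp: bounded_operator_def)
  ultimately show ?thesis
    unfolding bounded_operator_def by blast
qed

lemma bounded_operator_diff_fun:
  assumes W: "csubspace W" and A: "bounded_operator V W A" and B: "bounded_operator V W B"
  shows "bounded_operator V W (\<lambda>x. A x - B x)"
proof -
  obtain K where K: "K > 0" "\<And>x. x \<in> V \<Longrightarrow> norm (A x) \<le> K * norm x"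
    using bounded_operator_bound[OF A] by blast
  obtain L where L: "L > 0" "\<And>x. x \<in> V \<Longrightarrow> norm (B x) \<le> L * norm x"
    using bounded_operator_bound[OF B] by blast
  have "norm (A x - B x) \<le> (K + L) * norm x" if "x \<in> V" for x
    using K(2)[OF that] L(2)[OF that] norm_triangle_ineq4[of "A x" "B x"]
    by (simp add: distrib_right)
  moreover have "A x - B x \<in> W" if "x \<in> V" for x
    using that A B W by (auto simp: bounded_operator_def csubspace_diff)
  moreover have "A (x + y) - B (x + y) = A x - B x + (A y - B y)"
    "A (c *\<^sub>C x) - B (c *\<^sub>C x) = c *\<^sub>C (A x - B x)"
    if "x \<in> V" "y \<in> V" for x y c
    using that A B by (auto simp: bounded_operator_def scaleC_diff_right)
  ultimately show ?thesis
    unfolding bounded_operator_def by blast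
qed

lemma bounded_operator_scaleC_self:
  assumes "csubspace V"
  shows "bounded_operator V V (\<lambda>x. c *\<^sub>C x)"
  using assms unfolding bounded_operator_def
  by (intro conjI exI[of _ "cmod c"])
     (auto simp: csubspace_scaleC scaleC_add_right scaleC_scaleC mult.commute norm_scaleC)

lemma bounded_operator_mono:
  "bounded_operator V W A \<Longrightarrow> U \<subseteq> V \<Longrightarrow> W \<subseteq> X \<Longrightarrow> bounded_operator U X A"
  unfolding bounded_operator_def by blast

text \<open>Reduces vectors to scalars: holomorphy of eigenvector families is only stated through
  functionals, and pairing \<open>A x\<close> with itself detects whether it vanishes.\<close>

lemma bounded_operator_cinner:
  assumes A: "bounded_operator V W A"
  shows "bounded_operator V UNIV (\<lambda>x. cinner (A x) y)"
proof -
  have "bounded_operator W UNIV (\<lambda>x. cinner x y)"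
    unfolding bounded_operator_def
    by (auto simp: cinner_add_left cinner_scaleC_left scaleC_complex_def intro!: exI[of _ "norm y"])
       (metis cmod_cinner_le mult.commute)
  from bounded_operator_comp[OF this A] show ?thesis .
qed

text \<open>Applied with \<open>G\<close> the union of the eigenspaces, whose span is dense by the
  definition of the Cowen-Douglas class.\<close>

lemma bounded_operator_eq_0_on_closure_cspan:
  assumes A: "bounded_operator V W A" and V: "closure (cspan G) = V" "csubspace V"
    and G: "\<And>x. x \<in> G \<Longrightarrow> A x = 0" and x: "x \<in> V"
  shows "A x = 0"
proof -
  have GV: "cspan G \<subseteq> V"
    using V(1) closure_subset by blast
  have "csubspace {y \<in> V. A y = 0}"
    using V(2) bounded_operator_0[OF A V(2)]
    by (auto simp: csubspace_iff bounded_operator_add[OF A] bounded_operator_scaleC[OF A])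
  moreover have "G \<subseteq> {y \<in> V. A y = 0}"
    using GV G complex_vector.span_superset[of G] by auto
  ultimately have 0: "A y = 0" if "y \<in> cspan G" for y
    using that complex_vector.span_minimal[of G "{y \<in> V. A y = 0}"] by auto
  obtain K where K: "K > 0" "\<And>x. x \<in> V \<Longrightarrow> norm (A x) \<le> K * norm x"
    using bounded_operator_bound[OF A] by blast
  show ?thesis
  proof (rule ccontr)
    assume n: "A x \<noteq> 0"
    obtain y where y: "y \<in> cspan G" "dist y x < norm (A x) / K"
      using x V(1) n K(1) closure_approachable[of x "cspan G"]
      by (auto dest!: spec[of _ "norm (A x) / K"])
    have "norm (A x) = norm (A (x - y))"
      using 0[OF y(1)] bounded_operator_diff[OF A V(2) x, of y] subsetD[OF GV y(1)] by simp
    also have "\<dots> \<le> K * norm (x - y)"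
      by (rule K(2)[OF csubspace_diff[OF V(2) x subsetD[OF GV y(1)]]])
    also have "\<dots> < norm (A x)"
      using y(2) K(1) by (simp add: dist_norm norm_minus_commute field_simps)
    finally show False by simp
  qed
qed

subsection \<open>Orthogonal projections\<close>

lemma ortho_complement_closed_csubspace: "closed_csubspace (ortho_complement M)"
proof -
  have "closed {y. cinner x y = 0}" for x :: 'a
  proof -
    have "{y. cinner x y = 0} = {y. inner x y = 0} \<inter> {y. inner (\<i> *\<^sub>C x) y = 0}"
      by (auto simp: Re_cinner[symmetric] cinner_scaleC_left complex_eq_iff)
    moreover have "closed {y. inner z y = 0}" for z :: 'a
      by (intro closed_Collect_eq continuous_intros)
    ultimately show ?thesis
      by auto
  qed
  moreover have "ortho_complement M = (\<Inter>x\<in>M. {y. cinner x y = 0})"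
    by (auto simp: ortho_complement_def)
  ultimately have "closed (ortho_complement M)"
    by auto
  then show ?thesis
    by (auto simp: closed_csubspace_def csubspace_iff ortho_complement_def cinner_add_right
        cinner_scaleC_right)
qed

lemma parallelogram:
  fixes x y :: "'a::real_inner"
  shows "(norm (x + y))\<^sup>2 + (norm (x - y))\<^sup>2 = 2 * (norm x)\<^sup>2 + 2 * (norm y)\<^sup>2"
  by (simp add: power2_norm_eq_inner inner_add inner_diff inner_commute algebra_simps)

text \<open>A minimizing sequence is Cauchy: midpoints of its members stay in \<open>M\<close>,
  hence at distance at least \<open>d\<close> from \<open>z\<close>, and the parallelogram law then
  forces the members together.\<close>

lemma closest_point_in_closed_csubspace:
  fixes M :: "'a::complex_hilbert set"
  assumes M: "closed_csubspace M"
  obtains m where "m \<in> M" "\<And>v. v \<in> M \<Longrightarrow> norm (z - m) \<le> norm (z - v)"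
proof -
  have sub: "csubspace M" and cl: "closed M"
    using M by (auto simp: closed_csubspace_def)
  have ne: "M \<noteq> {}"
    using csubspace_0[OF sub] by auto
  define d where "d = infdist z M"
  have d0: "d \<ge> 0"
    by (simp add: d_def infdist_nonneg)
  have dle: "d \<le> norm (z - v)" if "v \<in> M" for v
    using infdist_le[OF that, of z] by (simp add: d_def dist_norm)
  have "\<exists>v\<in>M. (norm (z - v))\<^sup>2 < d\<^sup>2 + 1 / Suc n" for n
  proof -
    have "d < sqrt (d\<^sup>2 + 1 / Suc n)"
      by (rule real_less_rsqrt) simp
    then obtain v where "v \<in> M" "dist z v < sqrt (d\<^sup>2 + 1 / Suc n)"
      using cINF_less_iff[of M "dist z"] ne
      by (auto simp: d_def infdist_notempty intro!: bdd_belowI2[of _ 0])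
    then have "(norm (z - v))\<^sup>2 < (sqrt (d\<^sup>2 + 1 / Suc n))\<^sup>2"
      by (intro power_strict_mono) (auto simp: dist_norm)
    with \<open>v \<in> M\<close> show ?thesis
      by (auto simp: add_nonneg_nonneg)
  qed
  then obtain v where v: "\<And>n. v n \<in> M" "\<And>n. (norm (z - v n))\<^sup>2 < d\<^sup>2 + 1 / Suc n"
    by metis
  \<comment> \<open>Twice the two squared distances, minus \<open>4 * d^2\<close> from the midpoint,
    leaves twice the sum of two slacks of at most \<open>1 / Suc N\<close>.\<close>
  have close: "(norm (v m - v n))\<^sup>2 < 4 / Suc N" if "m \<ge> N" "n \<ge> N" for m n N
  proof -
    have le: "1 / real (Suc m) \<le> 1 / Suc N" "1 / real (Suc n) \<le> 1 / Suc N"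
      using that by (auto intro!: divide_left_mono)
    have half: "(1/2) *\<^sub>R (v m + v n) \<in> M"
      using csubspace_scaleC[OF sub csubspace_add[OF sub v(1)[of m] v(1)[of n]], of "complex_of_real (1/2)"]
      by (simp only: scaleC_of_real)
    have "(z - v m) + (z - v n) = 2 *\<^sub>R (z - (1/2) *\<^sub>R (v m + v n))"
      by (simp add: scaleR_2 algebra_simps)
    then have "norm ((z - v m) + (z - v n)) = 2 * norm (z - (1/2) *\<^sub>R (v m + v n))"
      by (metis norm_scaleR abs_numeral)
    then have "2 * d \<le> norm ((z - v m) + (z - v n))"
      using dle[OF half] by linarith
    then have "(2 * d)\<^sup>2 \<le> (norm ((z - v m) + (z - v n)))\<^sup>2"
      using d0 by (intro power_mono) auto
    moreover have "(norm (v m - v n))\<^sup>2 = (norm ((z - v m) - (z - v n)))\<^sup>2"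
      by (simp add: norm_minus_commute)
    ultimately have "(norm (v m - v n))\<^sup>2 + 4 * d\<^sup>2 \<le> 2 * (norm (z - v m))\<^sup>2 + 2 * (norm (z - v n))\<^sup>2"
      using parallelogram[of "z - v m" "z - v n"] by (simp add: power_mult_distrib)
    then show ?thesis
      using v(2)[of m] v(2)[of n] le by linarith
  qed
  have "Cauchy v"
    unfolding Cauchy_def
  proof (intro allI impI)
    fix e :: real
    assume e: "e > 0"
    obtain N where N: "4 / e\<^sup>2 < real N"
      using reals_Archimedean2 by blast
    have "4 / real (Suc N) \<le> e\<^sup>2"
      using N e by (simp add: field_simps) (smt (verit) mult_pos_pos zero_less_power)
    then have "dist (v m) (v n) < e" if "m \<ge> N" "n \<ge> N" for m n
      using close[OF that] e unfolding dist_norm by (intro power_less_imp_less_base[of _ 2 e]) auto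
    then show "\<exists>N. \<forall>m\<ge>N. \<forall>n\<ge>N. dist (v m) (v n) < e"
      by blast
  qed
  then obtain m where m: "v \<longlonglongrightarrow> m"
    by (auto simp: Cauchy_convergent_iff convergent_def)
  have mM: "m \<in> M"
    using closed_sequentially[OF cl _ m] v(1) by blast
  have "(\<lambda>n. (norm (z - v n))\<^sup>2) \<longlonglongrightarrow> (norm (z - m))\<^sup>2"
    by (intro tendsto_intros m)
  moreover have "(\<lambda>n. d\<^sup>2 + 1 / Suc n) \<longlonglongrightarrow> d\<^sup>2 + 0"
    using LIMSEQ_inverse_real_of_nat
    by (intro tendsto_add tendsto_const) (simp add: inverse_eq_divide)
  ultimately have "(norm (z - m))\<^sup>2 \<le> d\<^sup>2 + 0"
    by (rule LIMSEQ_le) (use v(2) in \<open>auto intro!: exI[of _ 0] less_imp_le\<close>)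
  then have "norm (z - m) \<le> d"
    using d0 by (simp add: power2_le_iff_abs_le)
  with dle mM show thesis
    by (intro that[of m]) (auto intro: order_trans)
qed

lemma orthogonal_decomposition_ortho_complement:
  fixes M :: "'a::complex_hilbert set"
  assumes M: "closed_csubspace M"
  shows "orthogonal_decomposition M (ortho_complement M)"
proof -
  have sub: "csubspace M"
    using M by (auto simp: closed_csubspace_def)
  have "\<exists>x\<in>M. \<exists>y\<in>ortho_complement M. z = x + y" for z
  proof -
    obtain m where m: "m \<in> M" "\<And>v. v \<in> M \<Longrightarrow> norm (z - m) \<le> norm (z - v)"
      using closest_point_in_closed_csubspace[OF M] by metis
    have inner0: "inner v (z - m) = 0" if v: "v \<in> M" for v
    proof (rule ccontr)
      assume nz: "inner v (z - m) \<noteq> 0"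
      then have vv: "inner v v > 0"
        by auto
      \<comment> \<open>The minimizer of \<open>norm ((z - m) - t *\<^sub>R v)\<close>: moving from
        \<open>m\<close> by this multiple of \<open>v\<close> would come strictly closer to
        \<open>z\<close>.\<close>
      define t where "t = inner v (z - m) / inner v v"
      have "m + t *\<^sub>R v \<in> M"
        using csubspace_add[OF sub m(1) csubspace_scaleC[OF sub v, of "of_real t"]]
        by (simp add: scaleC_of_real)
      then have "(norm (z - m))\<^sup>2 \<le> (norm ((z - m) - t *\<^sub>R v))\<^sup>2"
        using m(2) by (intro power_mono) (auto simp: algebra_simps)
      also have "\<dots> = (norm (z - m))\<^sup>2 - 2 * t * inner v (z - m) + t * t * inner v v"
        unfolding power2_norm_eq_inner by (simp add: inner_diff inner_commute algebra_simps)
      also have "t * t * inner v v = t * inner v (z - m)"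
        using vv by (simp add: t_def)
      finally have "t * inner v (z - m) \<le> 0"
        by simp
      moreover have "t * inner v (z - m) = (inner v (z - m))\<^sup>2 / inner v v"
        by (simp add: t_def power2_eq_square)
      ultimately show False
        using vv nz by (simp add: divide_le_0_iff)
    qed
    \<comment> \<open>Real orthogonality to \<open>v\<close> and to \<open>\<i> *\<^sub>C v\<close>
      removes the real and the imaginary part.\<close>
    have "cinner v (z - m) = 0" if "v \<in> M" for v
      using inner0[OF that] inner0[OF csubspace_scaleC[OF sub that, of \<i>]]
      by (simp add: Re_cinner[symmetric] cinner_scaleC_left complex_eq_iff)
    then show ?thesis
      using m(1) by (intro bexI[of _ m] bexI[of _ "z - m"]) (auto simp: ortho_complement_def)
  qed
  then show ?thesis
    using M ortho_complement_closed_csubspace[of M]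
    by (auto simp: orthogonal_decomposition_def ortho_complement_def)
qed

lemma orthogonal_decomposition_sym:
  assumes "orthogonal_decomposition H0 H1"
  shows "orthogonal_decomposition H1 H0"
  using assms unfolding orthogonal_decomposition_def
  by (metis add.commute cinner_commute complex_cnj_zero)

text \<open>For an orthogonal decomposition the choice is forced: two candidates differ by a vector
  lying in both \<open>H0\<close> and \<open>H1\<close>, which is orthogonal to itself.\<close>

definition oproj :: "'a::complex_inner set \<Rightarrow> 'a set \<Rightarrow> 'a \<Rightarrow> 'a" where
  "oproj H0 H1 z = (SOME x. x \<in> H0 \<and> z - x \<in> H1)"

lemma oproj_in:
  assumes "orthogonal_decomposition H0 H1"
  shows "oproj H0 H1 z \<in> H0" "z - oproj H0 H1 z \<in> H1"
proof -
  obtain x y where "x \<in> H0" "y \<in> H1" "z = x + y"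
    using assms unfolding orthogonal_decomposition_def by blast
  then have "x \<in> H0 \<and> z - x \<in> H1"
    by simp
  then have "oproj H0 H1 z \<in> H0 \<and> z - oproj H0 H1 z \<in> H1"
    unfolding oproj_def by (rule someI)
  then show "oproj H0 H1 z \<in> H0" "z - oproj H0 H1 z \<in> H1"
    by auto
qed

lemma oproj_add:
  assumes d: "orthogonal_decomposition H0 H1" and xy: "x \<in> H0" "y \<in> H1"
  shows "oproj H0 H1 (x + y) = x"
proof -
  define p where "p = oproj H0 H1 (x + y)"
  have p: "p \<in> H0" "x + y - p \<in> H1"
    using oproj_in[OF d] by (auto simp: p_def)
  have sub: "csubspace H0" "csubspace H1"
    using d by (auto simp: orthogonal_decomposition_def closed_csubspace_def)
  have "p - x \<in> H0"
    using p xy sub by (simp add: csubspace_diff)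
  moreover have "p - x \<in> H1"
    using csubspace_diff[OF sub(2) xy(2) p(2)] by simp
  ultimately have "cinner (p - x) (p - x) = 0"
    using d unfolding orthogonal_decomposition_def by blast
  then show ?thesis
    by (simp add: cinner_self_eq_0_iff p_def)
qed

lemma oproj_left:
  assumes "orthogonal_decomposition H0 H1" "x \<in> H0"
  shows "oproj H0 H1 x = x"
  using oproj_add[OF assms, of 0] assms(1)
  by (auto simp: orthogonal_decomposition_def closed_csubspace_def csubspace_0)

lemma oproj_right:
  assumes "orthogonal_decomposition H0 H1" "y \<in> H1"
  shows "oproj H0 H1 y = 0"
  using oproj_add[OF assms(1) _ assms(2), of 0] assms(1)
  by (auto simp: orthogonal_decomposition_def closed_csubspace_def csubspace_0)

lemma oproj_swap:
  assumes d: "orthogonal_decomposition H0 H1"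
  shows "oproj H1 H0 z = z - oproj H0 H1 z"
  using oproj_add[OF orthogonal_decomposition_sym[OF d] oproj_in(2)[OF d] oproj_in(1)[OF d], of z z]
  by simp

lemma bounded_operator_oproj:
  assumes d: "orthogonal_decomposition H0 H1"
  shows "bounded_operator UNIV H0 (oproj H0 H1)"
proof -
  have sub: "csubspace H0" "csubspace H1"
    using d by (auto simp: orthogonal_decomposition_def closed_csubspace_def)
  have "oproj H0 H1 (x + y) = oproj H0 H1 x + oproj H0 H1 y" for x y
    using oproj_add[OF d csubspace_add[OF sub(1) oproj_in(1)[OF d] oproj_in(1)[OF d]]
        csubspace_add[OF sub(2) oproj_in(2)[OF d] oproj_in(2)[OF d]], of x y x y]
    by (simp add: algebra_simps)
  moreover have "oproj H0 H1 (c *\<^sub>C x) = c *\<^sub>C oproj H0 H1 x" for c x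
    using oproj_add[OF d csubspace_scaleC[OF sub(1) oproj_in(1)[OF d]]
        csubspace_scaleC[OF sub(2) oproj_in(2)[OF d]], of c x c x]
    by (simp add: scaleC_diff_right)
  moreover have "norm (oproj H0 H1 x) \<le> 1 * norm x" for x
  proof -
    have "cinner (oproj H0 H1 x) (x - oproj H0 H1 x) = 0"
      using d oproj_in[OF d] unfolding orthogonal_decomposition_def by blast
    then have "inner (oproj H0 H1 x) (x - oproj H0 H1 x) = 0"
      by (metis Re_cinner zero_complex.sel(1))
    then have "(norm (oproj H0 H1 x))\<^sup>2 + (norm (x - oproj H0 H1 x))\<^sup>2 = (norm x)\<^sup>2"
      unfolding power2_norm_eq_inner by (simp add: inner_diff inner_commute)
    then have "(norm (oproj H0 H1 x))\<^sup>2 \<le> (norm x)\<^sup>2"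
      using zero_le_power2[of "norm (x - oproj H0 H1 x)"] by linarith
    then show ?thesis
      by (simp add: power2_le_iff_abs_le)
  qed
  ultimately show ?thesis
    using oproj_in(1)[OF d] unfolding bounded_operator_def by blast
qed

text \<open>Self-adjointness of the projection. In the irreducibility proof it lets invariance of
  \<open>H0\<close> under \<open>P\<close> pass to \<open>H1\<close>.\<close>

lemma cinner_oproj:
  assumes d: "orthogonal_decomposition H0 H1"
  shows "cinner (oproj H0 H1 x) y = cinner x (oproj H0 H1 y)"
proof -
  have "cinner (oproj H0 H1 x) (y - oproj H0 H1 y) = 0"
    using d oproj_in[OF d] unfolding orthogonal_decomposition_def by blast
  moreover have "cinner (x - oproj H0 H1 x) (oproj H0 H1 y) = 0"
    using orthogonal_decomposition_sym[OF d] oproj_in[OF d]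
    unfolding orthogonal_decomposition_def by blast
  ultimately show ?thesis
    using cinner_add_right[of "oproj H0 H1 x" "oproj H0 H1 y" "y - oproj H0 H1 y"]
    by (simp add: cinner_diff_left)
qed

subsection \<open>The open mapping theorem\<close>

text \<open>By Baire's theorem in the complete space \<open>W\<close>, the closure of the image of
  some ball has interior in \<open>W\<close>. Differences move that interior to the origin, and
  repeatedly correcting the residual, halved each time, removes the closure.\<close>

lemma bounded_preimages:
  fixes A :: "'a::complex_hilbert \<Rightarrow> 'b::complex_hilbert"
  assumes V: "closed_csubspace V" and W: "closed_csubspace W"
    and A: "bounded_operator V W A" and onto: "A ` V = W"
  obtains K where "K > 0" "\<And>y. y \<in> W \<Longrightarrow> \<exists>x\<in>V. A x = y \<and> norm x \<le> K * norm y"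
proof -
  have sV: "csubspace V" and cV: "closed V" and sW: "csubspace W" and cW: "closed W"
    using V W by (auto simp: closed_csubspace_def)
  define F where "F n = W \<inter> closure (A ` (V \<inter> cball 0 (real n)))" for n
  have W_eq: "W = (\<Union>n. F n)"
  proof
    show "W \<subseteq> (\<Union>n. F n)"
    proof
      fix y assume y: "y \<in> W"
      then obtain x where x: "x \<in> V" "A x = y"
        using onto by auto
      obtain n where "norm x \<le> real n"
        using real_arch_simple by blast
      with x have "y \<in> A ` (V \<inter> cball 0 (real n))"
        by auto
      with y show "y \<in> (\<Union>n. F n)"
        by (auto simp: F_def intro: subsetD[OF closure_subset])
    qed
  qed (auto simp: F_def)
  have "\<exists>n. (top_of_set W) interior_of (F n) \<noteq> {}"
  proof (rule ccontr)
    assume neg: "\<not> (\<exists>n. (top_of_set W) interior_of (F n) \<noteq> {})"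
    have "(top_of_set W) interior_of \<Union>(range F) = {}"
    proof (rule Baire_category_alt)
      show "completely_metrizable_space (top_of_set W) \<or>
            locally_compact_space (top_of_set W) \<and> regular_space (top_of_set W)"
        using completely_metrizable_space_closedin[OF completely_metrizable_space_euclidean] cW
        by auto
      show "closedin (top_of_set W) T \<and> (top_of_set W) interior_of T = {}" if "T \<in> range F" for T
        using that neg by (auto simp: F_def closedin_closed)
    qed simp
    moreover have "(top_of_set W) interior_of W = W"
      by (simp add: interior_of_eq)
    ultimately have "W = {}"
      using W_eq by simp
    then show False
      using csubspace_0[OF sW] by simp
  qed
  then obtain n y0 where "y0 \<in> (top_of_set W) interior_of (F n)"
    by blast
  then obtain U where U: "openin (top_of_set W) U" "y0 \<in> U" "U \<subseteq> F n"
    by (auto simp: interior_of_def)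
  then obtain e where e: "e > 0" "ball y0 e \<inter> W \<subseteq> U" and y0: "y0 \<in> W"
    unfolding openin_contains_ball by (meson subsetD)
  \<comment> \<open>Both \<open>y0\<close> and \<open>y0 + y\<close> are approximated within
    \<open>e / 16\<close> by images of vectors of norm at most \<open>n\<close>; subtracting doubles
    both bounds.\<close>
  have small: "\<exists>x\<in>V. norm x \<le> 2 * real n \<and> norm (y - A x) < e / 8"
    if y: "y \<in> W" "norm y < e" for y
  proof -
    have "y0 \<in> closure (A ` (V \<inter> cball 0 (real n)))" "y0 + y \<in> closure (A ` (V \<inter> cball 0 (real n)))"
      using e U(3) y0 y csubspace_add[OF sW y0 y(1)] by (auto simp: F_def dist_norm subset_iff)
    then obtain x1 x2 where x1: "x1 \<in> V" "norm x1 \<le> n" "dist (A x1) y0 < e / 16"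
      and x2: "x2 \<in> V" "norm x2 \<le> n" "dist (A x2) (y0 + y) < e / 16"
      using e(1) unfolding closure_approachable by (auto dest!: spec[of _ "e / 16"])
    have "y - A (x2 - x1) = (A x1 - y0) - (A x2 - (y0 + y))"
      using x1(1) x2(1) by (simp add: bounded_operator_diff[OF A sV])
    then have "norm (y - A (x2 - x1)) \<le> norm (A x1 - y0) + norm (A x2 - (y0 + y))"
      by (metis norm_triangle_ineq4)
    then have "norm (y - A (x2 - x1)) < e / 8"
      using x1(3) x2(3) unfolding dist_norm by linarith
    moreover have "norm (x2 - x1) \<le> 2 * real n"
      using x1(2) x2(2) norm_triangle_ineq4[of x2 x1] by simp
    ultimately show ?thesis
      using csubspace_diff[OF sV x2(1) x1(1)] by blast
  qed
  \<comment> \<open>Rescaling \<open>y\<close> to norm \<open>e / 2\<close> and back costs a factor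
    \<open>2 * norm y / e\<close>, applied to the preimage bound \<open>2 * (n + 1)\<close>. The
    \<open>+ 1\<close> keeps \<open>K\<close> positive for \<open>n = 0\<close>.\<close>
  define K where "K = 4 * (real n + 1) / e"
  have K: "K > 0"
    using e(1) by (simp add: K_def)
  have approx: "\<exists>x\<in>V. norm x \<le> K * norm y \<and> norm (y - A x) \<le> norm y / 2" if y: "y \<in> W" for y
  proof (cases "y = 0")
    case True
    then show ?thesis
      using csubspace_0[OF sV] bounded_operator_0[OF A sV] by auto
  next
    case False
    define t where "t = e / (2 * norm y)"
    have t: "t > 0" "t * norm y = e / 2" "inverse t = 2 * norm y / e"
      using False e(1) by (auto simp: t_def)
    have "complex_of_real t *\<^sub>C y \<in> W"
      using sW y by (simp add: csubspace_scaleC)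
    moreover have "norm (complex_of_real t *\<^sub>C y) < e"
      using t e(1) by (simp add: norm_scaleC)
    ultimately obtain x where x: "x \<in> V" "norm x \<le> 2 * real n"
        "norm (complex_of_real t *\<^sub>C y - A x) < e / 8"
      using small by blast
    define x' where "x' = complex_of_real (inverse t) *\<^sub>C x"
    have "y - A x' = complex_of_real (inverse t) *\<^sub>C (complex_of_real t *\<^sub>C y - A x)"
      using t(1) x(1)
      by (simp add: x'_def bounded_operator_scaleC[OF A] scaleC_diff_right scaleC_scaleC)
    then have "norm (y - A x') = inverse t * norm (complex_of_real t *\<^sub>C y - A x)"
      using t(1) by (simp only: norm_scaleC norm_of_real) simp
    also have "\<dots> \<le> inverse t * (e / 8)"
      using x(3) t(1) by (intro mult_left_mono) auto
    also have "\<dots> \<le> norm y / 2"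
      using e(1) by (simp add: t(3))
    finally have "norm (y - A x') \<le> norm y / 2" .
    moreover have "norm x' \<le> K * norm y"
    proof -
      have "norm x' = inverse t * norm x"
        using t(1) unfolding x'_def by (simp only: norm_scaleC norm_of_real) simp
      also have "\<dots> \<le> inverse t * (2 * (real n + 1))"
        using x(2) t(1) by (intro mult_left_mono) auto
      also have "\<dots> = K * norm y"
        by (simp add: t(3) K_def)
      finally show ?thesis .
    qed
    moreover have "x' \<in> V"
      using x(1) sV by (simp add: x'_def csubspace_scaleC)
    ultimately show ?thesis
      by blast
  qed
  then obtain g where g: "\<And>y. y \<in> W \<Longrightarrow> g y \<in> V" "\<And>y. y \<in> W \<Longrightarrow> norm (g y) \<le> K * norm y"
      "\<And>y. y \<in> W \<Longrightarrow> norm (y - A (g y)) \<le> norm y / 2"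
    by metis
  have "\<exists>x\<in>V. A x = y \<and> norm x \<le> 2 * K * norm y" if y: "y \<in> W" for y
  proof -
    \<comment> \<open>The residual after \<open>n\<close> corrections. The corrections have norms
      below a geometric series of ratio 1/2, whence the final constant \<open>2 * K\<close>, and
      their images telescope to \<open>r 0 = y\<close>.\<close>
    define r where "r n = ((\<lambda>u. u - A (g u)) ^^ n) y" for n
    have r_Suc: "r (Suc n) = r n - A (g (r n))" for n
      by (simp add: r_def)
    have rW: "r n \<in> W" for n
    proof (induction n)
      case (Suc n)
      then show ?case
        unfolding r_Suc using g(1) bounded_operator_in[OF A] csubspace_diff[OF sW] by blast
    qed (simp add: r_def y)
    have rn: "norm (r n) \<le> norm y * (1/2) ^ n" for n
    proof (induction n)
      case (Suc n)
      then show ?case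
        using g(3)[OF rW[of n]] by (simp add: r_Suc)
    qed (simp add: r_def)
    have le: "norm (g (r n)) \<le> K * norm y * (1/2) ^ n" for n
      using order_trans[OF g(2)[OF rW[of n]] mult_left_mono[OF rn[of n] less_imp_le[OF K]]]
      by (simp add: mult.assoc)
    have geo: "(\<lambda>n. K * norm y * (1/2) ^ n) sums (K * norm y * 2)"
      using sums_mult[OF geometric_sums[of "1/2::real"]] by simp
    have summ: "summable (\<lambda>n. g (r n))"
      by (rule summable_comparison_test'[OF sums_summable[OF geo], of 0]) (use le in auto)
    define x where "x = (\<Sum>n. g (r n))"
    have sx: "(\<lambda>n. g (r n)) sums x"
      using summ by (simp add: x_def summable_sums)
    have xV: "x \<in> V"
      by (rule closed_sequentially[OF cV _ sx[unfolded sums_def]])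
         (rule csubspace_sum[OF sV g(1)[OF rW]])
    have "norm x \<le> (\<Sum>n. K * norm y * (1/2) ^ n)"
      unfolding x_def by (rule norm_suminf_le[OF le sums_summable[OF geo]])
    also have "\<dots> = 2 * K * norm y"
      using sums_unique[OF geo] by simp
    finally have "norm x \<le> 2 * K * norm y" .
    moreover have "A x = y"
    proof -
      have "(\<lambda>n. A (g (r n))) sums A x"
        by (rule bounded_operator_sums[OF A sV g(1)[OF rW] sx xV])
      moreover have "(\<lambda>n. norm y * (1/2) ^ n) \<longlonglongrightarrow> norm y * 0"
        by (intro tendsto_mult_left LIMSEQ_power_zero) simp
      then have "r \<longlonglongrightarrow> 0"
        using Lim_null_comparison[OF always_eventually[OF allI[OF rn]]] by simp
      then have "(\<lambda>n. r n - r (Suc n)) sums (r 0 - 0)"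
        by (rule telescope_sums')
      then have "(\<lambda>n. A (g (r n))) sums y"
        by (simp add: r_Suc) (simp add: r_def)
      ultimately show ?thesis
        by (rule sums_unique2)
    qed
    ultimately show ?thesis
      using xV by blast
  qed
  moreover have "2 * K > 0"
    using K by simp
  ultimately show thesis
    using that by blast
qed

subsection \<open>Commutators commuting with an entry\<close>

(* The Kleinecke-Shirokov argument at an eigenvector: with L = T - w the relation
   [L^(n+1), A] = (n+1) C L^n gives L^n A^n e = n! h^n e, whose left side grows only geometrically. *)
lemma commutator_eigenvalue_eq_0:
  fixes V :: "'a::complex_inner set"
  assumes V: "csubspace V" and T: "bounded_operator V V T" and A: "bounded_operator V V A"
    and C: "\<And>x. x \<in> V \<Longrightarrow> C x = T (A x) - A (T x)"
    and comm: "\<And>x. x \<in> V \<Longrightarrow> C (T x) = T (C x)"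
    and e: "e \<in> V" "e \<noteq> 0" "T e = w *\<^sub>C e" "C e = h *\<^sub>C e"
  shows "h = 0"
proof (rule ccontr)
  assume h: "h \<noteq> 0"
  define L where "L x = T x - w *\<^sub>C x" for x
  have L: "bounded_operator V V L"
    unfolding L_def by (intro bounded_operator_diff_fun V T bounded_operator_scaleC_self)
  note TV = bounded_operator_in[OF T] and AV = bounded_operator_in[OF A]
    and LV = bounded_operator_in[OF L]
  have CV: "C x \<in> V" if "x \<in> V" for x
    using that by (simp add: C TV AV V csubspace_diff)
  have C_scale: "C (c *\<^sub>C x) = c *\<^sub>C C x" if "x \<in> V" for c x
    using that V
    by (simp add: C TV AV csubspace_scaleC bounded_operator_scaleC[OF T] bounded_operator_scaleC[OF A]
        scaleC_diff_right)
  have C_diff: "C (x - y) = C x - C y" if "x \<in> V" "y \<in> V" for x y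
    using that V
    by (simp add: C TV AV csubspace_diff bounded_operator_diff[OF T] bounded_operator_diff[OF A])
  \<comment> \<open>Subtracting the scalar \<open>w\<close> leaves the commutator unchanged, while
    it turns \<open>e\<close> into a null vector of \<open>L\<close>.\<close>
  have LA: "L (A x) = A (L x) + C x" if "x \<in> V" for x
    using that V
    by (simp add: L_def C TV AV csubspace_scaleC bounded_operator_diff[OF A] bounded_operator_scaleC[OF A])
  have LC: "L (C x) = C (L x)" if "x \<in> V" for x
    using that V by (simp add: L_def comm TV CV csubspace_scaleC C_diff C_scale)
  have LnV: "(L ^^ n) x \<in> V" if "x \<in> V" for n x
    using that by (induction n) (simp_all add: LV)
  have AnV: "(A ^^ n) e \<in> V" for n
    by (induction n) (simp_all add: AV e)
  have key: "(L ^^ Suc n) (A x) = A ((L ^^ Suc n) x) + of_nat (Suc n) *\<^sub>C C ((L ^^ n) x)"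
    if x: "x \<in> V" for n x
  proof (induction n)
    case 0
    then show ?case
      using x by (simp add: LA)
  next
    case (Suc n)
    define u where "u = (L ^^ n) x"
    have u: "u \<in> V"
      using x by (simp add: u_def LnV)
    have "(L ^^ Suc (Suc n)) (A x) = L (A (L u) + of_nat (Suc n) *\<^sub>C C u)"
      using Suc by (simp add: u_def)
    also have "\<dots> = L (A (L u)) + of_nat (Suc n) *\<^sub>C L (C u)"
      using u by (simp add: bounded_operator_add[OF L] bounded_operator_scaleC[OF L] AV LV CV
          csubspace_scaleC V)
    also have "\<dots> = A (L (L u)) + (C (L u) + of_nat (Suc n) *\<^sub>C C (L u))"
      using u by (simp add: LA LC LV)
    also have "C (L u) + of_nat (Suc n) *\<^sub>C C (L u) = of_nat (Suc (Suc n)) *\<^sub>C C (L u)"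
      using scaleC_add_left[of 1 "of_nat (Suc n)" "C (L u)"]
      by (simp only: scaleC_one of_nat_Suc[of "Suc n"])
    finally show ?case
      by (simp add: u_def)
  qed
  have Le: "L e = 0"
    by (simp add: L_def e)
  have main: "(L ^^ n) ((A ^^ n) e) = (fact n * h ^ n) *\<^sub>C e" for n
  proof (induction n)
    case (Suc n)
    \<comment> \<open>By the induction hypothesis \<open>(L ^^ n) ((A ^^ n) e)\<close> is a multiple
      of the null vector \<open>e\<close>. So the first term of \<open>key\<close> at
      \<open>(A ^^ n) e\<close> drops out, and the second multiplies by
      \<open>(n + 1) * h\<close>.\<close>
    have "(L ^^ Suc n) ((A ^^ n) e) = L ((fact n * h ^ n) *\<^sub>C e)"
      using Suc by simp
    also have "\<dots> = 0"
      by (simp add: bounded_operator_scaleC[OF L e(1)] Le)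
    finally have "(L ^^ Suc n) ((A ^^ Suc n) e) = of_nat (Suc n) *\<^sub>C C ((fact n * h ^ n) *\<^sub>C e)"
      using key[OF AnV[of n], of n] Suc by (simp add: bounded_operator_0[OF A V] del: of_nat_Suc)
    also have "\<dots> = (fact (Suc n) * h ^ Suc n) *\<^sub>C e"
      by (simp add: C_scale e scaleC_scaleC mult_ac)
    finally show ?case .
  qed simp
  obtain K where K: "K > 0" "\<And>x. x \<in> V \<Longrightarrow> norm (L x) \<le> K * norm x"
    using bounded_operator_bound[OF L] by blast
  obtain M where M: "M > 0" "\<And>x. x \<in> V \<Longrightarrow> norm (A x) \<le> M * norm x"
    using bounded_operator_bound[OF A] by blast
  have Ln: "norm ((L ^^ n) x) \<le> K ^ n * norm x" if "x \<in> V" for n x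
  proof (induction n)
    case (Suc n)
    show ?case
      using order_trans[OF K(2)[OF LnV[OF that, of n]] mult_left_mono[OF Suc less_imp_le[OF K(1)]]]
      by (simp add: mult.assoc)
  qed simp
  have An: "norm ((A ^^ n) e) \<le> M ^ n * norm e" for n
  proof (induction n)
    case (Suc n)
    show ?case
      using order_trans[OF M(2)[OF AnV[of n]] mult_left_mono[OF Suc less_imp_le[OF M(1)]]]
      by (simp add: mult.assoc)
  qed simp
  \<comment> \<open>All terms of the exponential series of \<open>K * M / cmod h\<close> would be at
    least 1, although they tend to 0.\<close>
  have ge: "1 \<le> inverse (fact n) * (K * M / cmod h) ^ n" for n
  proof -
    have "fact n * cmod h ^ n * norm e = norm ((L ^^ n) ((A ^^ n) e))"
      by (simp add: main norm_scaleC norm_mult norm_power)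
    also have "\<dots> \<le> K ^ n * (M ^ n * norm e)"
      using order_trans[OF Ln[OF AnV] mult_left_mono[OF An]] K(1) by simp
    finally have "(fact n * cmod h ^ n) * norm e \<le> (K * M) ^ n * norm e"
      by (simp add: power_mult_distrib mult_ac)
    then have "fact n * cmod h ^ n \<le> (K * M) ^ n"
      using e(2) by simp
    then show ?thesis
      using h by (simp add: field_simps)
  qed
  have "(\<lambda>n. inverse (fact n) * (K * M / cmod h) ^ n) \<longlonglongrightarrow> 0"
    by (rule summable_LIMSEQ_zero[OF summable_exp])
  then have "1 \<le> (0::real)"
    by (rule LIMSEQ_le_const) (use ge in auto)
  then show False
    by simp
qed

subsection \<open>Holomorphic eigenvector families\<close>

text \<open>Used in two ways: an operator commuting with \<open>T\<close> acts on the eigenspace by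
  a scalar, and checking a linear condition on the eigenspace comes down to one nonzero
  eigenvector.\<close>

lemma kernel_minus_line:
  assumes dim: "cdim (kernel_minus V T w) = 1"
    and e: "e \<in> kernel_minus V T w" "e \<noteq> 0" and x: "x \<in> kernel_minus V T w"
  obtains c where "x = c *\<^sub>C e"
proof -
  obtain B where B: "kernel_minus V T w \<subseteq> cspan B" "card B = 1"
    using complex_vector.basis_exists[of "kernel_minus V T w"] dim by metis
  then obtain b where b: "kernel_minus V T w \<subseteq> cspan {b}"
    by (auto simp: card_1_singleton_iff)
  have "e \<in> range (\<lambda>c. c *\<^sub>C b)" "x \<in> range (\<lambda>c. c *\<^sub>C b)"
    using b e(1) x by (auto simp: complex_vector.span_singleton)
  then obtain c d where cd: "e = c *\<^sub>C b" "x = d *\<^sub>C b"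
    by blast
  then have "x = (d / c) *\<^sub>C e"
    using e(2) by (auto simp: scaleC_scaleC)
  then show thesis
    by (rule that)
qed

lemma kernel_minus_nonzero:
  assumes "cdim (kernel_minus V T w) \<noteq> 0"
  obtains e where "e \<in> kernel_minus V T w" "e \<noteq> 0"
proof -
  have "\<not> kernel_minus V T w \<subseteq> {0}"
    using assms complex_vector.dim_le_card[of "kernel_minus V T w" "{}"] by auto
  then show thesis
    using that by auto
qed

lemma cowen_douglasD:
  assumes "T \<in> cowen_douglas n \<Omega> V"
  shows "closed_csubspace V" "csubspace V" "bounded_operator V V T"
    "w \<in> \<Omega> \<Longrightarrow> cdim (kernel_minus V T w) = n"
    "w \<in> \<Omega> \<Longrightarrow> (\<lambda>x. T x - w *\<^sub>C x) ` V = V"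
    "closure (cspan (\<Union>w\<in>\<Omega>. kernel_minus V T w)) = V" "n \<noteq> 0"
  using assms by (auto simp: cowen_douglas_def closed_csubspace_def)

lemma kernel_minus_iff: "x \<in> kernel_minus V T w \<longleftrightarrow> x \<in> V \<and> T x = w *\<^sub>C x"
  by (auto simp: kernel_minus_def)

(* The family is the sum of (w - w0)^n e_n with (T - w0) e_(n+1) = e_n, where the open mapping
   theorem lets the e_n grow at most geometrically. *)
lemma local_eigenvector_family:
  fixes T :: "'a::complex_hilbert \<Rightarrow> 'a"
  assumes T: "T \<in> cowen_douglas n \<Omega> V" and \<Omega>: "open \<Omega>" "w0 \<in> \<Omega>"
  obtains r \<gamma> where "r > 0" "ball w0 r \<subseteq> \<Omega>"
    "\<And>w. w \<in> ball w0 r \<Longrightarrow> \<gamma> w \<in> kernel_minus V T w"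
    "\<And>w. w \<in> ball w0 r \<Longrightarrow> \<gamma> w \<noteq> 0"
    "\<And>\<phi> :: 'a \<Rightarrow> complex. bounded_operator V UNIV \<phi> \<Longrightarrow> (\<lambda>w. \<phi> (\<gamma> w)) holomorphic_on ball w0 r"
proof -
  note cd = cowen_douglasD[OF T]
  have cV: "closed V"
    using cd(1) by (simp add: closed_csubspace_def)
  define L where "L x = T x - w0 *\<^sub>C x" for x
  have L: "bounded_operator V V L"
    unfolding L_def by (intro bounded_operator_diff_fun cd bounded_operator_scaleC_self)
  obtain K where K: "K > 0" "\<And>y. y \<in> V \<Longrightarrow> \<exists>x\<in>V. L x = y \<and> norm x \<le> K * norm y"
    using bounded_preimages[OF cd(1) cd(1) L] cd(5)[OF \<Omega>(2)] unfolding L_def by metis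
  then obtain g where g: "\<And>y. y \<in> V \<Longrightarrow> g y \<in> V" "\<And>y. y \<in> V \<Longrightarrow> L (g y) = y"
      "\<And>y. y \<in> V \<Longrightarrow> norm (g y) \<le> K * norm y"
    by metis
  obtain e0 where e0: "e0 \<in> kernel_minus V T w0" "e0 \<noteq> 0"
    using kernel_minus_nonzero[of V T w0] cd(4)[OF \<Omega>(2)] cd(7) by metis
  then have Le0: "L e0 = 0" and e0V: "e0 \<in> V"
    by (auto simp: kernel_minus_iff L_def)
  define e where "e n = (g ^^ n) e0" for n
  have e_0: "e 0 = e0" and e_Suc: "e (Suc n) = g (e n)" for n
    by (simp_all add: e_def)
  have eV: "e n \<in> V" for n
    by (induction n) (simp_all add: e_0 e_Suc e0V g(1))
  have Le: "L (e (Suc n)) = e n" for n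
    by (simp add: e_Suc g(2) eV)
  have en: "norm (e n) \<le> K ^ n * norm e0" for n
  proof (induction n)
    case (Suc n)
    show ?case
      using order_trans[OF g(3)[OF eV[of n]] mult_left_mono[OF Suc less_imp_le[OF K(1)]]]
      by (simp add: mult.assoc e_Suc)
  qed (simp add: e_0)
  obtain r0 where r0: "r0 > 0" "ball w0 r0 \<subseteq> \<Omega>"
    using \<Omega> by (auto simp: open_contains_ball)
  \<comment> \<open>Keeps \<open>cmod (w - w0) * K\<close> below 1/2, which gives convergence and,
    through \<open>fn2\<close>, also nonvanishing of the sum.\<close>
  define r where "r = min r0 (1 / (2 * K))"
  define f where "f w n = (w - w0) ^ n *\<^sub>C e n" for w n
  define \<gamma> where "\<gamma> w = (\<Sum>n. f w n)" for w
  have fV: "f w n \<in> V" for w n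
    by (simp add: f_def csubspace_scaleC cd(2) eV)
  have q: "cmod (w - w0) * K < 1 / 2" if "w \<in> ball w0 r" for w
  proof -
    have "cmod (w - w0) < 1 / (2 * K)"
      using that by (simp add: r_def dist_norm norm_minus_commute)
    then show ?thesis
      using K(1) by (simp add: field_simps)
  qed
  have fn: "norm (f w n) \<le> norm e0 * (cmod (w - w0) * K) ^ n" for w n
    using mult_left_mono[OF en[of n], of "cmod (w - w0) ^ n"]
    by (simp add: f_def norm_scaleC norm_power power_mult_distrib mult_ac)
  \<comment> \<open>One factor \<open>cmod (w - w0) * K\<close> stays outside the geometric bound,
    so that the tail after \<open>e0\<close> sums to strictly less than \<open>norm e0\<close> and
    cannot cancel it.\<close>
  have fn2: "norm (f w (Suc n)) \<le> (norm e0 * (cmod (w - w0) * K)) * (1/2) ^ n"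
    if "w \<in> ball w0 r" for w n
  proof -
    have "(cmod (w - w0) * K) ^ n \<le> (1/2) ^ n"
      using q[OF that] K(1) by (intro power_mono) auto
    then have "norm e0 * (cmod (w - w0) * K) * (cmod (w - w0) * K) ^ n
        \<le> norm e0 * (cmod (w - w0) * K) * (1/2) ^ n"
      using K(1) by (intro mult_left_mono) auto
    then show ?thesis
      using fn[of w "Suc n"] by (simp add: mult_ac)
  qed
  have geo: "(\<lambda>n. c * (1/2) ^ n) sums (c * 2)" for c :: real
    using sums_mult[OF geometric_sums[of "1/2::real"]] by simp
  have summ_Suc: "summable (\<lambda>n. f w (Suc n))" if "w \<in> ball w0 r" for w
    by (rule summable_comparison_test'[OF sums_summable[OF geo], of 0]) (use fn2[OF that] in auto)
  then have f_sums: "f w sums \<gamma> w" if "w \<in> ball w0 r" for w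
    using summ_Suc[OF that] by (simp add: \<gamma>_def summable_sums summable_Suc_iff)
  have \<gamma>V: "\<gamma> w \<in> V" if "w \<in> ball w0 r" for w
    by (rule closed_sequentially[OF cV _ f_sums[OF that, unfolded sums_def]])
       (rule csubspace_sum[OF cd(2) fV])
  have \<gamma>0: "\<gamma> w \<noteq> 0" if w: "w \<in> ball w0 r" for w
  proof
    assume 0: "\<gamma> w = 0"
    have "(\<lambda>n. f w (Suc n)) sums (- e0)"
      using f_sums[OF w] 0 by (subst sums_Suc_iff) (simp add: f_def e_0)
    then have "norm e0 = norm (\<Sum>n. f w (Suc n))"
      using sums_unique by (metis norm_minus_cancel)
    also have "\<dots> \<le> (\<Sum>n. (norm e0 * (cmod (w - w0) * K)) * (1/2) ^ n)"
      by (rule norm_suminf_le[OF fn2[OF w] sums_summable[OF geo]])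
    also have "\<dots> = norm e0 * (cmod (w - w0) * K * 2)"
      using sums_unique[OF geo] by (metis mult.assoc)
    also have "\<dots> < norm e0 * 1"
      using q[OF w] e0(2) by (intro mult_strict_left_mono) auto
    finally show False
      by simp
  qed
  have "T (\<gamma> w) = w *\<^sub>C \<gamma> w" if w: "w \<in> ball w0 r" for w
  proof -
    have "(\<lambda>n. L (f w n)) sums L (\<gamma> w)"
      by (rule bounded_operator_sums[OF L cd(2) fV f_sums[OF w] \<gamma>V[OF w]])
    moreover have "L (f w 0) = 0"
      by (simp add: f_def e_0 Le0)
    ultimately have "(\<lambda>n. L (f w (Suc n))) sums L (\<gamma> w)"
      by (subst sums_Suc_iff) simp
    \<comment> \<open>\<open>L\<close> lowers the index by one, so on the shifted series it acts as
      multiplication by \<open>w - w0\<close>; the term of index 0 was already in its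
      kernel.\<close>
    moreover have "L (f w (Suc n)) = (w - w0) *\<^sub>C f w n" for n
      by (simp only: f_def bounded_operator_scaleC[OF L eV] Le scaleC_scaleC power_Suc)
    ultimately have "(\<lambda>n. (w - w0) *\<^sub>C f w n) sums L (\<gamma> w)"
      by simp
    moreover have "(\<lambda>n. (w - w0) *\<^sub>C f w n) sums ((w - w0) *\<^sub>C \<gamma> w)"
      by (rule bounded_operator_sums[OF bounded_operator_scaleC_self[OF cd(2)] cd(2) fV f_sums[OF w] \<gamma>V[OF w]])
    ultimately have "L (\<gamma> w) = (w - w0) *\<^sub>C \<gamma> w"
      by (rule sums_unique2)
    then show ?thesis
      using scaleC_add_left[of "w - w0" w0 "\<gamma> w"] by (simp add: L_def algebra_simps)
  qed
  then have ker: "\<gamma> w \<in> kernel_minus V T w" if "w \<in> ball w0 r" for w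
    using that \<gamma>V by (simp add: kernel_minus_iff)
  have hol: "(\<lambda>w. \<phi> (\<gamma> w)) holomorphic_on ball w0 r" if \<phi>: "bounded_operator V UNIV \<phi>"
    for \<phi> :: "'a \<Rightarrow> complex"
  proof (rule power_series_holomorphic)
    fix w assume w: "w \<in> ball w0 r"
    have "(\<lambda>n. \<phi> (f w n)) sums \<phi> (\<gamma> w)"
      by (rule bounded_operator_sums[OF \<phi> cd(2) fV f_sums[OF w] \<gamma>V[OF w]])
    moreover have "\<phi> (f w n) = \<phi> (e n) * (w - w0) ^ n" for n
      by (simp add: f_def bounded_operator_scaleC[OF \<phi> eV] scaleC_complex_def)
    ultimately show "(\<lambda>n. \<phi> (e n) * (w - w0) ^ n) sums \<phi> (\<gamma> w)"
      by simp
  qed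
  show thesis
  proof (rule that[of r \<gamma>])
    show "r > 0" "ball w0 r \<subseteq> \<Omega>"
      using r0 K(1) by (auto simp: r_def)
  qed (use ker \<gamma>0 hol in auto)
qed

section \<open>Operators tested on the eigenlines\<close>

text \<open>On a line spanned by \<open>\<gamma> w\<close>, injectivity of \<open>B\<close> means
  \<open>B (\<gamma> w) \<noteq> 0\<close>. This persists near \<open>w0\<close>, because the
  pairing of \<open>B (\<gamma> w)\<close> with the fixed vector \<open>B (\<gamma> w0)\<close> is
  continuous in \<open>w\<close> and nonzero at \<open>w0\<close>.\<close>

lemma nonzero_on_kernels_near:
  fixes T :: "'a::complex_hilbert \<Rightarrow> 'a"
  assumes T: "T \<in> cowen_douglas 1 \<Omega> V" and \<Omega>: "open \<Omega>" "w0 \<in> \<Omega>"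
    and B: "bounded_operator V W B" and x: "x \<in> kernel_minus V T w0" "B x \<noteq> 0"
  obtains r where "r > 0" "ball w0 r \<subseteq> \<Omega>"
    "\<And>w x. w \<in> ball w0 r \<Longrightarrow> x \<in> kernel_minus V T w \<Longrightarrow> B x = 0 \<Longrightarrow> x = 0"
proof -
  note cd = cowen_douglasD[OF T]
  obtain r \<gamma> where r: "r > 0" "ball w0 r \<subseteq> \<Omega>"
    "\<And>w. w \<in> ball w0 r \<Longrightarrow> \<gamma> w \<in> kernel_minus V T w"
    "\<And>w. w \<in> ball w0 r \<Longrightarrow> \<gamma> w \<noteq> 0"
    "\<And>\<phi> :: 'a \<Rightarrow> complex. bounded_operator V UNIV \<phi> \<Longrightarrow> (\<lambda>w. \<phi> (\<gamma> w)) holomorphic_on ball w0 r"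
    using local_eigenvector_family[OF T \<Omega>] by metis
  have \<gamma>V: "\<gamma> w \<in> V" if "w \<in> ball w0 r" for w
    using r(3)[OF that] by (simp add: kernel_minus_iff)
  have w0: "w0 \<in> ball w0 r"
    using r(1) by simp
  obtain c where c: "x = c *\<^sub>C \<gamma> w0"
    using kernel_minus_line[OF cd(4)[OF \<Omega>(2)] r(3)[OF w0] r(4)[OF w0] x(1)] by metis
  have nz: "B (\<gamma> w0) \<noteq> 0"
    using x(2) by (auto simp: c bounded_operator_scaleC[OF B \<gamma>V[OF w0]])
  define \<phi> where "\<phi> z = cinner (B z) (B (\<gamma> w0))" for z
  have "(\<lambda>w. \<phi> (\<gamma> w)) holomorphic_on ball w0 r"
    unfolding \<phi>_def by (rule r(5)[OF bounded_operator_cinner[OF B]])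
  then have "continuous_on (ball w0 r) (\<lambda>w. \<phi> (\<gamma> w))"
    by (rule holomorphic_on_imp_continuous_on)
  moreover have "\<phi> (\<gamma> w0) \<noteq> 0"
    using nz by (simp add: \<phi>_def cinner_self_eq_0_iff)
  ultimately obtain d where d: "d > 0" "\<And>w. w \<in> ball w0 r \<Longrightarrow> dist w0 w < d \<Longrightarrow> \<phi> (\<gamma> w) \<noteq> 0"
    using continuous_on_avoid[of "ball w0 r" "\<lambda>w. \<phi> (\<gamma> w)" w0 0] w0 by blast
  show thesis
  proof (rule that[of "min r d"])
    show "min r d > 0" "ball w0 (min r d) \<subseteq> \<Omega>"
      using r(1,2) d(1) by auto
    fix w y assume w: "w \<in> ball w0 (min r d)" and y: "y \<in> kernel_minus V T w" "B y = 0"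
    then have wr: "w \<in> ball w0 r" and "B (\<gamma> w) \<noteq> 0"
      using d(2)[of w] by (auto simp: \<phi>_def)
    obtain a where a: "y = a *\<^sub>C \<gamma> w"
      using kernel_minus_line[OF cd(4) r(3)[OF wr] r(4)[OF wr] y(1)] r(2) wr by blast
    then show "y = 0"
      using y(2) \<open>B (\<gamma> w) \<noteq> 0\<close> by (auto simp: bounded_operator_scaleC[OF B \<gamma>V[OF wr]] scaleC_eq_0_iff)
  qed
qed

text \<open>The identity theorem along local sections spreads the vanishing over all of \<Omega>,
  and density of the span of the eigenvectors then spreads it over \<open>V\<close>.\<close>

lemma eq_0_if_zero_on_open_set_of_kernels:
  fixes T :: "'a::complex_hilbert \<Rightarrow> 'a"
  assumes T: "T \<in> cowen_douglas 1 \<Omega> V" and \<Omega>: "open \<Omega>" "connected \<Omega>"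
    and B: "bounded_operator V W B" and U: "open U" "U \<noteq> {}" "U \<subseteq> \<Omega>"
    and 0: "\<And>w x. w \<in> U \<Longrightarrow> x \<in> kernel_minus V T w \<Longrightarrow> B x = 0" and x: "x \<in> V"
  shows "B x = 0"
proof -
  note cd = cowen_douglasD[OF T]
  define N where "N = {w. \<forall>x\<in>kernel_minus V T w. B x = 0}"
  \<comment> \<open>The interior is taken so that a ball meeting \<open>Z\<close> meets it in a
    nonempty open set, as the identity theorem requires.\<close>
  define Z where "Z = interior (\<Omega> \<inter> N)"
  have step: "w0 \<in> Z" if w0: "w0 \<in> \<Omega>" and r: "r > 0" "ball w0 r \<subseteq> \<Omega>"
    "\<And>w. w \<in> ball w0 r \<Longrightarrow> \<gamma> w \<in> kernel_minus V T w"
    "\<And>w. w \<in> ball w0 r \<Longrightarrow> \<gamma> w \<noteq> 0"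
    "\<And>\<phi> :: 'a \<Rightarrow> complex. bounded_operator V UNIV \<phi> \<Longrightarrow> (\<lambda>w. \<phi> (\<gamma> w)) holomorphic_on ball w0 r"
    and ne: "Z \<inter> ball w0 r \<noteq> {}" for w0 r \<gamma>
  proof -
    have B\<gamma>: "B (\<gamma> w) = 0" if w: "w \<in> ball w0 r" for w
    proof -
      have "cinner (B (\<gamma> w)) (B (\<gamma> w)) = 0"
      proof -
        \<comment> \<open>Freezing the second argument is essential:
          \<open>cinner (B (\<gamma> v)) (B (\<gamma> v))\<close> is not holomorphic in
          \<open>v\<close>, whereas the pairing with a fixed \<open>y\<close> is.\<close>
        define y where "y = B (\<gamma> w)"
        have "cinner (B (\<gamma> w)) y = 0"
        proof (rule analytic_continuation_open[of "Z \<inter> ball w0 r" "ball w0 r"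
              "\<lambda>w. cinner (B (\<gamma> w)) y" "\<lambda>_. 0"])
          show "(\<lambda>w. cinner (B (\<gamma> w)) y) holomorphic_on ball w0 r"
            by (rule r(5)[OF bounded_operator_cinner[OF B]])
          show "cinner (B (\<gamma> v)) y = 0" if "v \<in> Z \<inter> ball w0 r" for v
            using that r(3)[of v] interior_subset[of "\<Omega> \<inter> N"] by (auto simp: Z_def N_def)
        qed (use ne w in \<open>auto simp: Z_def\<close>)
        then show ?thesis
          by (simp add: y_def)
      qed
      then show ?thesis
        by (simp add: cinner_self_eq_0_iff)
    qed
    have "ball w0 r \<subseteq> \<Omega> \<inter> N"
    proof
      fix w assume w: "w \<in> ball w0 r"
      have "B y = 0" if y: "y \<in> kernel_minus V T w" for y
      proof -
        obtain a where "y = a *\<^sub>C \<gamma> w"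
          using kernel_minus_line[OF cd(4) r(3)[OF w] r(4)[OF w] y] r(2) w by blast
        moreover have "\<gamma> w \<in> V"
          using r(3)[OF w] by (simp add: kernel_minus_iff)
        ultimately show ?thesis
          by (simp add: bounded_operator_scaleC[OF B] B\<gamma>[OF w])
      qed
      then show "w \<in> \<Omega> \<inter> N"
        using w r(2) by (auto simp: N_def)
    qed
    then show ?thesis
      using r(1) unfolding Z_def by (meson centre_in_ball interior_maximal open_ball subsetD)
  qed
  \<comment> \<open>A ball with a local section that met \<open>Z\<close> would put its centre into
    \<open>Z\<close>; so around a centre outside \<open>Z\<close> the ball avoids
    \<open>Z\<close>.\<close>
  have "open (\<Omega> - Z)"
  proof (subst open_contains_ball, rule ballI)
    fix w0 assume w0: "w0 \<in> \<Omega> - Z"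
    then obtain r \<gamma> where r: "r > 0" "ball w0 r \<subseteq> \<Omega>"
      "\<And>w. w \<in> ball w0 r \<Longrightarrow> \<gamma> w \<in> kernel_minus V T w"
      "\<And>w. w \<in> ball w0 r \<Longrightarrow> \<gamma> w \<noteq> 0"
      "\<And>\<phi> :: 'a \<Rightarrow> complex. bounded_operator V UNIV \<phi> \<Longrightarrow> (\<lambda>w. \<phi> (\<gamma> w)) holomorphic_on ball w0 r"
      using local_eigenvector_family[OF T \<Omega>(1), of w0] by (metis DiffD1)
    have "Z \<inter> ball w0 r = {}"
      using step[OF _ r] w0 by blast
    then show "\<exists>e>0. ball w0 e \<subseteq> \<Omega> - Z"
      using r(1,2) by blast
  qed
  moreover have "Z \<subseteq> \<Omega>"
    using interior_subset[of "\<Omega> \<inter> N"] by (auto simp: Z_def)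
  moreover have "U \<subseteq> Z"
    unfolding Z_def by (rule interior_maximal) (use U 0 in \<open>auto simp: N_def\<close>)
  ultimately have "\<Omega> \<subseteq> Z"
    using connectedD[OF \<Omega>(2), of Z "\<Omega> - Z"] U(2) by (auto simp: Z_def)
  then have N: "\<Omega> \<subseteq> N"
    using interior_subset[of "\<Omega> \<inter> N"] by (auto simp: Z_def)
  show ?thesis
    by (rule bounded_operator_eq_0_on_closure_cspan[OF B cd(6) cd(2) _ x]) (use N in \<open>auto simp: N_def\<close>)
qed

lemma nonzero_on_some_kernel:
  fixes T :: "'a::complex_hilbert \<Rightarrow> 'a"
  assumes T: "T \<in> cowen_douglas n \<Omega> V" and B: "bounded_operator V W B"
    and x: "x \<in> V" "B x \<noteq> 0"
  obtains w y where "w \<in> \<Omega>" "y \<in> kernel_minus V T w" "B y \<noteq> 0"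
proof (rule ccontr)
  assume "\<not> thesis"
  with that have "B y = 0" if "y \<in> (\<Union>w\<in>\<Omega>. kernel_minus V T w)" for y
    using that by blast
  then have "B x = 0"
    using bounded_operator_eq_0_on_closure_cspan[OF B cowen_douglasD(6,2)[OF T] _ x(1)] by blast
  with x(2) show False ..
qed

text \<open>\<open>Q\<close> maps each eigenline into itself and \<open>Q (z - Q z) = 0\<close>.
  Where \<open>Q\<close> is injective on eigenlines, which is an open condition, this forces
  \<open>Q z = z\<close>, and continuation extends that to all of \<open>V\<close>.\<close>

lemma commuting_idempotent_trivial:
  fixes T :: "'a::complex_hilbert \<Rightarrow> 'a"
  assumes T: "T \<in> cowen_douglas 1 \<Omega> V" and \<Omega>: "open \<Omega>" "connected \<Omega>"
    and Q: "bounded_operator V V Q" and idem: "\<And>x. x \<in> V \<Longrightarrow> Q (Q x) = Q x"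
    and comm: "\<And>x. x \<in> V \<Longrightarrow> Q (T x) = T (Q x)"
  shows "(\<forall>x\<in>V. Q x = 0) \<or> (\<forall>x\<in>V. Q x = x)"
proof (cases "\<forall>x\<in>V. Q x = 0")
  case False
  note cd = cowen_douglasD[OF T]
  obtain w0 y where w0: "w0 \<in> \<Omega>" and y: "y \<in> kernel_minus V T w0" "Q y \<noteq> 0"
    using nonzero_on_some_kernel[OF T Q] False by metis
  obtain r where r: "r > 0" "ball w0 r \<subseteq> \<Omega>"
    "\<And>w x. w \<in> ball w0 r \<Longrightarrow> x \<in> kernel_minus V T w \<Longrightarrow> Q x = 0 \<Longrightarrow> x = 0"
    using nonzero_on_kernels_near[OF T \<Omega>(1) w0 Q y] by metis
  have D: "bounded_operator V V (\<lambda>x. x - Q x)"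
    using bounded_operator_diff_fun[OF cd(2) bounded_operator_scaleC_self[OF cd(2), of 1] Q] by simp
  have "x - Q x = 0" if x: "x \<in> V" for x
  proof (rule eq_0_if_zero_on_open_set_of_kernels[OF T \<Omega> D open_ball _ r(2) _ x])
    show "ball w0 r \<noteq> {}"
      using r(1) by simp
    fix w z assume w: "w \<in> ball w0 r" and z: "z \<in> kernel_minus V T w"
    then have zV: "z \<in> V" and QV: "Q z \<in> V"
      using bounded_operator_in[OF Q] by (auto simp: kernel_minus_iff)
    have "z - Q z \<in> kernel_minus V T w"
      using z zV QV comm[OF zV] bounded_operator_scaleC[OF Q zV]
      by (auto simp: kernel_minus_iff bounded_operator_diff[OF cd(3,2)] csubspace_diff cd(2)
          scaleC_diff_right)
    moreover have "Q (z - Q z) = 0"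
      using zV QV by (simp add: bounded_operator_diff[OF Q cd(2)] idem)
    ultimately show "z - Q z = 0"
      using r(3)[OF w] by blast
  qed
  then show ?thesis
    by auto
qed simp

subsection \<open>Operators commuting with a flag operator\<close>

lemma FB2_decompositionD:
  assumes "FB2_decomposition \<Omega> T H0 H1 T0 S T1"
  shows "orthogonal_decomposition H0 H1" "T0 \<in> cowen_douglas 1 \<Omega> H0" "T1 \<in> cowen_douglas 1 \<Omega> H1"
    "bounded_operator H1 H0 S" "\<exists>y\<in>H1. S y \<noteq> 0"
    "y \<in> H1 \<Longrightarrow> T0 (S y) = S (T1 y)"
    "x \<in> H0 \<Longrightarrow> T x = T0 x" "y \<in> H1 \<Longrightarrow> T y = S y + T1 y"
    "x \<in> H0 \<Longrightarrow> y \<in> H1 \<Longrightarrow> T (x + y) = (T0 x + S y) + T1 y"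
proof -
  note d = assms[unfolded FB2_decomposition_def]
  show od: "orthogonal_decomposition H0 H1" and T0: "T0 \<in> cowen_douglas 1 \<Omega> H0"
    and T1: "T1 \<in> cowen_douglas 1 \<Omega> H1" and S: "bounded_operator H1 H0 S" and "\<exists>y\<in>H1. S y \<noteq> 0"
    using d by auto
  show "y \<in> H1 \<Longrightarrow> T0 (S y) = S (T1 y)"
    using d by auto
  note cd0 = cowen_douglasD[OF T0] and cd1 = cowen_douglasD[OF T1]
  show T: "T (x + y) = (T0 x + S y) + T1 y" if "x \<in> H0" "y \<in> H1" for x y
    using d that by auto
  show "T x = T0 x" if "x \<in> H0"
    using T[OF that csubspace_0[OF cd1(2)]] bounded_operator_0[OF S cd1(2)]
      bounded_operator_0[OF cd1(3,2)] by simp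
  show "T y = S y + T1 y" if "y \<in> H1"
    using T[OF csubspace_0[OF cd0(2)] that] bounded_operator_0[OF cd0(3,2)] by simp
qed

(* For the blocks of P, commutation with T gives S P21 = [P11, T0], and S P21 commutes with T0.
   Hence the scalars by which S P21 acts on the lines ker(T0 - w) vanish. *)
lemma FB2_commutant_upper_triangular:
  fixes T :: "'h::complex_hilbert \<Rightarrow> 'h"
  assumes \<Omega>: "open \<Omega>" "connected \<Omega>" and dec: "FB2_decomposition \<Omega> T H0 H1 T0 S T1"
    and P: "bounded_operator UNIV UNIV P" and PT: "P \<circ> T = T \<circ> P"
    and x: "x \<in> H0"
  shows "P x \<in> H0"
proof -
  note fb = FB2_decompositionD[OF dec]
  note od = fb(1) and od' = orthogonal_decomposition_sym[OF fb(1)]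
  note cd0 = cowen_douglasD[OF fb(2)] and cd1 = cowen_douglasD[OF fb(3)]
  define A where "A z = oproj H0 H1 (P z)" for z
  define N where "N z = oproj H1 H0 (P z)" for z
  have AU: "bounded_operator UNIV H0 A" and NU: "bounded_operator UNIV H1 N"
    unfolding A_def N_def by (intro bounded_operator_comp[OF _ P] bounded_operator_oproj od od')+
  have A: "bounded_operator H0 H0 A" and N: "bounded_operator H0 H1 N"
    using bounded_operator_mono[OF AU] bounded_operator_mono[OF NU] by auto
  have AN: "P z = A z + N z" for z
    by (simp add: A_def N_def oproj_swap[OF od])
  have A_H0: "A z \<in> H0" and N_H1: "N z \<in> H1" for z
    using bounded_operator_in[OF AU] bounded_operator_in[OF NU] by auto
  have TP: "T (P z) = (T0 (A z) + S (N z)) + T1 (N z)" for z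
    using fb(9)[OF A_H0 N_H1] by (simp add: AN)
  have in_H0: "T0 (A z) + S (N z) \<in> H0" and in_H1: "T1 (N z) \<in> H1" for z
    using bounded_operator_in[OF cd0(3) A_H0] bounded_operator_in[OF fb(4) N_H1]
      bounded_operator_in[OF cd1(3) N_H1] csubspace_add[OF cd0(2)] by auto
  have A_T0: "A (T0 z) = T0 (A z) + S (N z)" and N_T0: "N (T0 z) = T1 (N z)" if "z \<in> H0" for z
  proof -
    have PT: "P (T0 z) = (T0 (A z) + S (N z)) + T1 (N z)"
      using fun_cong[OF PT, of z] fb(7)[OF that] by (simp add: TP)
    show "A (T0 z) = T0 (A z) + S (N z)"
      unfolding A_def[of "T0 z"] PT by (rule oproj_add[OF od in_H0 in_H1])
    show "N (T0 z) = T1 (N z)"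
      unfolding N_def[of "T0 z"] PT using oproj_add[OF od' in_H1 in_H0] by (simp add: add.commute)
  qed
  have SN: "S (N z) = 0" if w: "w \<in> \<Omega>" and z: "z \<in> kernel_minus H0 T0 w" for w z
  proof (cases "z = 0")
    case True
    then show ?thesis
      using bounded_operator_0[OF N cd0(2)] bounded_operator_0[OF fb(4) cd1(2)] by simp
  next
    case False
    have zH: "z \<in> H0" and Tz: "T0 z = w *\<^sub>C z"
      using z by (auto simp: kernel_minus_iff)
    have SN_T0: "S (N (T0 u)) = T0 (S (N u))" if "u \<in> H0" for u
      using N_T0[OF that] fb(6)[OF N_H1[of u]] by simp
    have "S (N z) \<in> kernel_minus H0 T0 w"
      using SN_T0[OF zH] bounded_operator_in[OF fb(4) N_H1]
      by (simp add: kernel_minus_iff Tz bounded_operator_scaleC[OF N zH]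
          bounded_operator_scaleC[OF fb(4) N_H1])
    then obtain c where c: "S (N z) = c *\<^sub>C z"
      using kernel_minus_line[OF cd0(4)[OF w] z False] by metis
    \<comment> \<open>The commutator of \<open>T0\<close> with \<open>A\<close>, in this order, is
      minus \<open>S N\<close> on \<open>H0\<close>, so its eigenvalue at \<open>z\<close> is
      \<open>- c\<close>.\<close>
    define C where "C u = T0 (A u) - A (T0 u)" for u
    have C: "C u = (- 1) *\<^sub>C S (N u)" if "u \<in> H0" for u
      using A_T0[OF that] by (simp add: C_def scaleC_minus_one)
    have "- c = 0"
    proof (rule commutator_eigenvalue_eq_0[OF cd0(2) cd0(3) A _ _ zH False Tz])
      show "C u = T0 (A u) - A (T0 u)" for u
        by (rule C_def)
      show "C (T0 u) = T0 (C u)" if u: "u \<in> H0" for u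
        by (simp only: C[OF u] C[OF bounded_operator_in[OF cd0(3) u]] SN_T0[OF u]
            bounded_operator_scaleC[OF cd0(3) bounded_operator_in[OF fb(4) N_H1]])
      show "C z = (- c) *\<^sub>C z"
        using C[OF zH] by (simp add: c scaleC_scaleC)
    qed
    then show ?thesis
      by (simp add: c)
  qed
  \<comment> \<open>\<open>S\<close> may vanish on some eigenlines of \<open>T1\<close>;
    \<open>N\<close> can be cancelled from \<open>S (N z) = 0\<close> only over a ball where it does
    not.\<close>
  obtain w0 y where w0: "w0 \<in> \<Omega>" and y: "y \<in> kernel_minus H1 T1 w0" "S y \<noteq> 0"
    using nonzero_on_some_kernel[OF fb(3) fb(4)] fb(5) by metis
  obtain r where r: "r > 0" "ball w0 r \<subseteq> \<Omega>"
    "\<And>w x. w \<in> ball w0 r \<Longrightarrow> x \<in> kernel_minus H1 T1 w \<Longrightarrow> S x = 0 \<Longrightarrow> x = 0"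
    using nonzero_on_kernels_near[OF fb(3) \<Omega>(1) w0 fb(4) y] by metis
  have "N x = 0"
  proof (rule eq_0_if_zero_on_open_set_of_kernels[OF fb(2) \<Omega> N open_ball _ r(2) _ x])
    show "ball w0 r \<noteq> {}"
      using r(1) by simp
    fix w z assume w: "w \<in> ball w0 r" and z: "z \<in> kernel_minus H0 T0 w"
    then have zH: "z \<in> H0" and "T0 z = w *\<^sub>C z"
      by (auto simp: kernel_minus_iff)
    then have "N z \<in> kernel_minus H1 T1 w"
      using N_T0[OF zH] N_H1 by (simp add: kernel_minus_iff bounded_operator_scaleC[OF N zH])
    moreover have "S (N z) = 0"
      using SN[OF _ z] r(2) w by blast
    ultimately show "N z = 0"
      by (rule r(3)[OF w])
  qed
  then show ?thesis
    using AN[of x] A_H0[of x] by simp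
qed

text \<open>The right column of \<open>P T = T P\<close>. Because \<open>P\<close> preserves
  \<open>H0\<close>, the vector \<open>P (S y)\<close> enters the upper entry whole and is absent
  from the lower one.\<close>

lemma FB2_commutant_blocks:
  fixes T :: "'h::complex_hilbert \<Rightarrow> 'h"
  assumes \<Omega>: "open \<Omega>" "connected \<Omega>" and dec: "FB2_decomposition \<Omega> T H0 H1 T0 S T1"
    and P: "bounded_operator UNIV UNIV P" and PT: "P \<circ> T = T \<circ> P"
    and y: "y \<in> H1"
  shows "P (S y) + oproj H0 H1 (P (T1 y)) = T0 (oproj H0 H1 (P y)) + S (oproj H1 H0 (P y))"
    and "oproj H1 H0 (P (T1 y)) = T1 (oproj H1 H0 (P y))"
proof -
  note fb = FB2_decompositionD[OF dec]
  note od = fb(1) and od' = orthogonal_decomposition_sym[OF fb(1)]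
  note cd0 = cowen_douglasD[OF fb(2)] and cd1 = cowen_douglasD[OF fb(3)]
  define a where "a = oproj H0 H1 (P y)"
  define b where "b = oproj H1 H0 (P y)"
  have ab: "a \<in> H0" "b \<in> H1" "P y = a + b"
    by (simp_all add: a_def b_def oproj_in[OF od] oproj_in[OF od'] oproj_swap[OF od])
  have PS: "P (S y) \<in> H0"
    by (rule FB2_commutant_upper_triangular[OF \<Omega> dec P PT bounded_operator_in[OF fb(4) y]])
  have TP: "T (P y) = (T0 a + S b) + T1 b"
    using fb(9)[OF ab(1,2)] by (simp add: ab(3))
  have in_H0: "T0 a + S b \<in> H0" and in_H1: "T1 b \<in> H1"
    using bounded_operator_in[OF cd0(3) ab(1)] bounded_operator_in[OF fb(4) ab(2)]
      bounded_operator_in[OF cd1(3) ab(2)] csubspace_add[OF cd0(2)] by auto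
  have eq: "P (S y) + P (T1 y) = (T0 a + S b) + T1 b"
    using fun_cong[OF PT, of y] bounded_operator_add[OF P, of "S y" "T1 y"] by (simp add: TP fb(8)[OF y])
  have "P (S y) + oproj H0 H1 (P (T1 y)) = oproj H0 H1 (P (S y) + P (T1 y))"
    using bounded_operator_add[OF bounded_operator_oproj[OF od]] oproj_left[OF od PS] by simp
  also have "\<dots> = T0 a + S b"
    unfolding eq by (rule oproj_add[OF od in_H0 in_H1])
  finally show "P (S y) + oproj H0 H1 (P (T1 y)) = T0 (oproj H0 H1 (P y)) + S (oproj H1 H0 (P y))"
    by (simp add: a_def b_def)
  have "oproj H1 H0 (P (T1 y)) = oproj H1 H0 (P (S y) + P (T1 y))"
    using bounded_operator_add[OF bounded_operator_oproj[OF od']] oproj_right[OF od' PS] by simp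
  also have "\<dots> = T1 b"
    unfolding eq using oproj_add[OF od' in_H1 in_H0] by (simp add: add.commute)
  finally show "oproj H1 H0 (P (T1 y)) = T1 (oproj H1 H0 (P y))"
    by (simp add: b_def)
qed

text \<open>For a block upper triangular idempotent the diagonal blocks are idempotent too:
  \<open>P\<close> sends the \<open>H0\<close> part of \<open>P y\<close> into \<open>H0\<close>, so
  it contributes nothing to the \<open>H1\<close> component of \<open>P (P y)\<close>.\<close>

lemma FB2_commuting_idempotent_diagonal:
  fixes T :: "'h::complex_hilbert \<Rightarrow> 'h"
  assumes \<Omega>: "open \<Omega>" "connected \<Omega>" and dec: "FB2_decomposition \<Omega> T H0 H1 T0 S T1"
    and P: "bounded_operator UNIV UNIV P" and PT: "P \<circ> T = T \<circ> P"
    and PP: "P \<circ> P = P"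
  shows "(\<forall>x\<in>H0. P x = 0) \<or> (\<forall>x\<in>H0. P x = x)"
    and "(\<forall>y\<in>H1. oproj H1 H0 (P y) = 0) \<or> (\<forall>y\<in>H1. oproj H1 H0 (P y) = y)"
proof -
  note fb = FB2_decompositionD[OF dec]
  note od = fb(1) and od' = orthogonal_decomposition_sym[OF fb(1)]
  note ut = FB2_commutant_upper_triangular[OF \<Omega> dec P PT]
  have idem: "P (P z) = P z" for z
    using fun_cong[OF PP, of z] by simp
  show "(\<forall>x\<in>H0. P x = 0) \<or> (\<forall>x\<in>H0. P x = x)"
  proof (rule commuting_idempotent_trivial[OF fb(2) \<Omega>])
    show "bounded_operator H0 H0 P"
      using P ut unfolding bounded_operator_def by auto
    show "P (T0 x) = T0 (P x)" if "x \<in> H0" for x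
      using fun_cong[OF PT, of x] fb(7)[OF that] fb(7)[OF ut[OF that]] by simp
  qed (rule idem)
  show "(\<forall>y\<in>H1. oproj H1 H0 (P y) = 0) \<or> (\<forall>y\<in>H1. oproj H1 H0 (P y) = y)"
  proof (rule commuting_idempotent_trivial[OF fb(3) \<Omega>])
    show "bounded_operator H1 H1 (\<lambda>y. oproj H1 H0 (P y))"
      using bounded_operator_mono[OF bounded_operator_comp[OF bounded_operator_oproj[OF od'] P]] by blast
    show "oproj H1 H0 (P (T1 y)) = T1 (oproj H1 H0 (P y))" if "y \<in> H1" for y
      by (rule FB2_commutant_blocks(2)[OF \<Omega> dec P PT that])
    show "oproj H1 H0 (P (oproj H1 H0 (P y))) = oproj H1 H0 (P y)" for y
    proof -
      have "P (oproj H1 H0 (P y)) = P y - P (oproj H0 H1 (P y))"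
        using bounded_operator_diff[OF P complex_vector.subspace_UNIV] by (simp add: oproj_swap[OF od] idem)
      then have "P y = P (oproj H0 H1 (P y)) + P (oproj H1 H0 (P y))"
        by simp
      then have "oproj H1 H0 (P y) = oproj H1 H0 (P (oproj H0 H1 (P y))) + oproj H1 H0 (P (oproj H1 H0 (P y)))"
        using bounded_operator_add[OF bounded_operator_oproj[OF od']] by (metis UNIV_I)
      moreover have "oproj H1 H0 (P (oproj H0 H1 (P y))) = 0"
        by (rule oproj_right[OF od' ut[OF oproj_in(1)[OF od]]])
      ultimately show ?thesis
        by simp
    qed
  qed
qed

section \<open>Irreducibility\<close>

text \<open>The bridge from reducing subspaces to the commutant: the two summands are invariant, so
  \<open>T\<close> respects the splitting of \<open>z\<close>.\<close>

lemma oproj_commute_reducing: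
  fixes T :: "'a::complex_hilbert \<Rightarrow> 'a"
  assumes T: "bounded_operator UNIV UNIV T" and M: "reducing_subspace T M"
  shows "oproj M (ortho_complement M) (T z) = T (oproj M (ortho_complement M) z)"
proof -
  have od: "orthogonal_decomposition M (ortho_complement M)"
    using M by (auto simp: reducing_subspace_def intro: orthogonal_decomposition_ortho_complement)
  define u where "u = oproj M (ortho_complement M) z"
  have u: "T u \<in> M" "T (z - u) \<in> ortho_complement M"
    using M oproj_in[OF od, of z] unfolding reducing_subspace_def u_def by blast+
  have "T z = T u + T (z - u)"
    using bounded_operator_add[OF T, of u "z - u"] by simp
  then show ?thesis
    using oproj_add[OF od u] by (simp add: u_def)
qed

lemma FB2_irreducible:
  fixes T :: "'h::complex_hilbert \<Rightarrow> 'h"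
  assumes \<Omega>: "open \<Omega>" "connected \<Omega>" and T: "bounded_operator UNIV UNIV T"
    and dec: "FB2_decomposition \<Omega> T H0 H1 T0 S T1"
  shows "irreducible_operator T"
  unfolding irreducible_operator_def
proof (intro allI impI)
  fix M assume M: "reducing_subspace T M"
  define P where "P = oproj M (ortho_complement M)"
  have odM: "orthogonal_decomposition M (ortho_complement M)"
    using M by (auto simp: reducing_subspace_def intro: orthogonal_decomposition_ortho_complement)
  have PM: "P z \<in> M" for z
    by (simp add: P_def oproj_in[OF odM])
  have PMid: "P z = z" if "z \<in> M" for z
    using that by (simp add: P_def oproj_left[OF odM])
  have P: "bounded_operator UNIV UNIV P"
    unfolding P_def using bounded_operator_mono[OF bounded_operator_oproj[OF odM]] by blast
  have PT: "P \<circ> T = T \<circ> P"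
    unfolding P_def by (rule ext) (simp add: oproj_commute_reducing[OF T M])
  have PP: "P \<circ> P = P"
    by (rule ext) (simp add: PMid PM)
  note fb = FB2_decompositionD[OF dec]
  note od = fb(1) and od' = orthogonal_decomposition_sym[OF fb(1)]
  \<comment> \<open>The \<open>H0\<close> part \<open>u\<close> of \<open>P y\<close> vanishes: by
    self-adjointness its square is the pairing of \<open>y\<close> with \<open>P u\<close>, which
    lies in \<open>H0\<close>.\<close>
  have H1: "P y \<in> H1" if y: "y \<in> H1" for y
  proof -
    define u where "u = oproj H0 H1 (P y)"
    have u: "u \<in> H0"
      by (simp add: u_def oproj_in[OF od])
    have "cinner u u = cinner (P y) (oproj H0 H1 u)"
      unfolding u_def by (rule cinner_oproj[OF od])
    also have "\<dots> = cinner y (P u)"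
      by (simp add: oproj_left[OF od u] P_def cinner_oproj[OF odM])
    also have "\<dots> = 0"
      using FB2_commutant_upper_triangular[OF \<Omega> dec P PT u] od' y
      unfolding orthogonal_decomposition_def by blast
    finally have "u = 0"
      by (simp add: cinner_self_eq_0_iff)
    then show ?thesis
      using oproj_in(2)[OF od, of "P y"] by (simp add: u_def)
  qed
  have T1H1: "T1 y \<in> H1" if "y \<in> H1" for y
    using bounded_operator_in[OF cowen_douglasD(3)[OF fb(3)] that] .
  \<comment> \<open>Now \<open>P (T1 y)\<close> and \<open>P y\<close> have no \<open>H0\<close>
    part, so the upper right block identity loses both terms with \<open>P12\<close>.\<close>
  have PS: "P (S y) = S (P y)" if y: "y \<in> H1" for y
    using FB2_commutant_blocks(1)[OF \<Omega> dec P PT y] bounded_operator_0[OF cowen_douglasD(3,2)[OF fb(2)]]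
    by (simp add: oproj_right[OF od] oproj_left[OF od'] H1 T1H1 y)
  have SH0: "S y \<in> H0" if "y \<in> H1" for y
    by (rule bounded_operator_in[OF fb(4) that])
  have S0: "S 0 = 0"
    by (rule bounded_operator_0[OF fb(4) cowen_douglasD(2)[OF fb(3)]])
  \<comment> \<open>A single vector outside the kernel of \<open>S\<close> excludes the two mixed
    cases, where \<open>P\<close> is 0 on one summand and the identity on the other.\<close>
  obtain y0 where y0: "y0 \<in> H1" "S y0 \<noteq> 0"
    using fb(5) by blast
  have d1: "(\<forall>y\<in>H1. P y = 0) \<or> (\<forall>y\<in>H1. P y = y)"
    using FB2_commuting_idempotent_diagonal(2)[OF \<Omega> dec P PT PP]
    by (simp add: oproj_left[OF od'] H1)
  have split: "P z = P (oproj H0 H1 z) + P (oproj H1 H0 z)" for z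
    using bounded_operator_add[OF P, of "oproj H0 H1 z" "oproj H1 H0 z"] by (simp add: oproj_swap[OF od])
  from FB2_commuting_idempotent_diagonal(1)[OF \<Omega> dec P PT PP]
  show "M = {0} \<or> M = UNIV"
  proof
    assume 0: "\<forall>x\<in>H0. P x = 0"
    then have "S (P y0) = 0"
      using PS[OF y0(1)] SH0[OF y0(1)] by simp
    then have "\<forall>y\<in>H1. P y = 0"
      using d1 y0 by auto
    then have "P z = 0" for z
      using 0 oproj_in(1)[OF od] oproj_in(1)[OF od'] split[of z] by simp
    then have "M \<subseteq> {0}"
      using PMid by auto
    moreover have "0 \<in> M"
      using PM[of 0] \<open>\<And>z. P z = 0\<close> by simp
    ultimately show ?thesis
      by blast
  next
    assume 1: "\<forall>x\<in>H0. P x = x"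
    then have "S (P y0) \<noteq> 0"
      using PS[OF y0(1)] SH0[OF y0(1)] y0(2) by simp
    then have "\<forall>y\<in>H1. P y = y"
      using d1 y0 S0 by auto
    then have "P z = z" for z
      using 1 oproj_in(1)[OF od] oproj_in(1)[OF od'] split[of z]
      by (simp add: oproj_swap[OF od])
    then show ?thesis
      using PM by (metis UNIV_eq_I)
  qed
qed

section \<open>Strong irreducibility\<close>

lemma FB2_strongly_irreducible:
  fixes T :: "'h::complex_hilbert \<Rightarrow> 'h"
  assumes \<Omega>: "open \<Omega>" "connected \<Omega>"
    and dec: "FB2_decomposition \<Omega> T H0 H1 T0 S T1" and inv: "invertible_operator H1 H0 S"
  shows "strongly_irreducible_operator T"
  unfolding strongly_irreducible_operator_def
proof (intro allI impI, elim conjE)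
  fix P assume P: "bounded_operator UNIV UNIV P" and PP: "P \<circ> P = P" and PT: "P \<circ> T = T \<circ> P"
  have idem: "P (P z) = P z" for z
    using fun_cong[OF PP, of z] by simp
  note fb = FB2_decompositionD[OF dec]
  note od = fb(1) and od' = orthogonal_decomposition_sym[OF fb(1)]
  note cd0 = cowen_douglasD[OF fb(2)] and cd1 = cowen_douglasD[OF fb(3)]
  define X where "X y = oproj H0 H1 (P y)" for y
  define D where "D y = oproj H1 H0 (P y)" for y
  have XU: "bounded_operator UNIV H0 X"
    unfolding X_def by (intro bounded_operator_comp[OF _ P] bounded_operator_oproj od)
  have X: "bounded_operator H1 H0 X"
    using bounded_operator_mono[OF XU] by blast
  have block: "P (S y) + X (T1 y) = T0 (X y) + S (D y)" if "y \<in> H1" for y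
    using FB2_commutant_blocks(1)[OF \<Omega> dec P PT that] by (simp add: X_def D_def)
  have PXD: "P y = X y + D y" for y
    by (simp add: X_def D_def oproj_swap[OF od])
  have X_H0: "X y \<in> H0" for y
    using bounded_operator_in[OF XU] by simp
  obtain R where R: "bounded_operator H0 H1 R" "\<And>y. y \<in> H1 \<Longrightarrow> R (S y) = y" "\<And>x. x \<in> H0 \<Longrightarrow> S (R x) = x"
    using inv unfolding invertible_operator_def by blast
  have R_H1: "R x \<in> H1" if "x \<in> H0" for x
    by (rule bounded_operator_in[OF R(1) that])
  \<comment> \<open>Multiplying \<open>T0 S = S T1\<close> by the inverse \<open>R\<close> on both
    sides; this turns \<open>X T1 R\<close> into \<open>X R T0\<close>, a product of operators on
    \<open>H0\<close> alone.\<close>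
  have R_T0: "R (T0 x) = T1 (R x)" if "x \<in> H0" for x
    using fb(6)[OF R_H1[OF that]] R(2)[OF bounded_operator_in[OF cd1(3) R_H1[OF that]]] R(3)[OF that]
    by simp
  (* (1/k) X S^-1 would make the identity of H0 a commutator of bounded operators. *)
  have no_commutator: False if k: "k \<noteq> 0" "\<And>y. y \<in> H1 \<Longrightarrow> T0 (X y) - X (T1 y) = k *\<^sub>C S y" for k
  proof -
    obtain w where w: "w \<in> \<Omega>"
      using nonzero_on_some_kernel[OF fb(3) fb(4)] fb(5) by metis
    obtain e where e: "e \<in> kernel_minus H0 T0 w" "e \<noteq> 0"
      using kernel_minus_nonzero[of H0 T0 w] cd0(4)[OF w] by auto
    have C: "T0 (X (R x)) - X (R (T0 x)) = k *\<^sub>C x" if "x \<in> H0" for x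
      using k(2)[OF R_H1[OF that]] that by (simp add: R_T0 R(3))
    have "k = 0"
    proof (rule commutator_eigenvalue_eq_0[OF cd0(2) cd0(3) bounded_operator_comp[OF X R(1)]])
      show "k *\<^sub>C x = T0 (X (R x)) - X (R (T0 x))" if "x \<in> H0" for x
        using C[OF that] by simp
      show "k *\<^sub>C T0 x = T0 (k *\<^sub>C x)" if "x \<in> H0" for x
        by (simp add: bounded_operator_scaleC[OF cd0(3) that])
      show "e \<in> H0" "e \<noteq> 0" "T0 e = w *\<^sub>C e" "k *\<^sub>C e = k *\<^sub>C e"
        using e by (auto simp: kernel_minus_iff)
    qed
    then show False
      using k(1) by simp
  qed
  have split: "P z = P (oproj H0 H1 z) + P (oproj H1 H0 z)" for z
    using bounded_operator_add[OF P, of "oproj H0 H1 z" "oproj H1 H0 z"] by (simp add: oproj_swap[OF od])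
  have SH0: "S y \<in> H0" if "y \<in> H1" for y
    by (rule bounded_operator_in[OF fb(4) that])
  have S0: "S 0 = 0"
    by (rule bounded_operator_0[OF fb(4) cd1(2)])
  have dD: "(\<forall>y\<in>H1. D y = 0) \<or> (\<forall>y\<in>H1. D y = y)"
    using FB2_commuting_idempotent_diagonal(2)[OF \<Omega> dec P PT PP] by (simp add: D_def)
  from FB2_commuting_idempotent_diagonal(1)[OF \<Omega> dec P PT PP]
  show "P = (\<lambda>x. 0) \<or> P = id"
  proof
    assume 0: "\<forall>x\<in>H0. P x = 0"
    have "\<not> (\<forall>y\<in>H1. D y = y)"
    proof
      assume 1: "\<forall>y\<in>H1. D y = y"
      have "T0 (X y) - X (T1 y) = (- 1) *\<^sub>C S y" if "y \<in> H1" for y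
        using block[OF that] 0 1 SH0[OF that] that by (simp add: scaleC_minus_one algebra_simps)
      then show False
        using no_commutator[of "- 1"] by simp
    qed
    \<comment> \<open>Idempotence removes the off-diagonal block: \<open>P y = X y\<close> lies in
      \<open>H0\<close>, where \<open>P\<close> vanishes, so
      \<open>P y = P (P y) = 0\<close>.\<close>
    then have "P y = 0" if "y \<in> H1" for y
      using dD that PXD[of y] 0 X_H0[of y] idem[of y] by auto
    then have "P z = 0" for z
      using 0 oproj_in(1)[OF od] oproj_in(1)[OF od'] split[of z] by simp
    then show ?thesis
      by auto
  next
    assume 1: "\<forall>x\<in>H0. P x = x"
    have "\<not> (\<forall>y\<in>H1. D y = 0)"
    proof
      assume 0: "\<forall>y\<in>H1. D y = 0"
      have "T0 (X y) - X (T1 y) = 1 *\<^sub>C S y" if "y \<in> H1" for y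
        using block[OF that] 0 1 SH0[OF that] that S0 by (simp add: algebra_simps)
      then show False
        using no_commutator[of 1] by simp
    qed
    then have D1: "D y = y" if "y \<in> H1" for y
      using dD that by auto
    have "P y = y" if y: "y \<in> H1" for y
    proof -
      \<comment> \<open>Here idempotence gives \<open>P y = X y + P y\<close>, so the off-diagonal
        part \<open>X y\<close> is 0.\<close>
      have "P y = P (X y + D y)"
        using idem[of y] PXD[of y] by simp
      also have "\<dots> = X y + P y"
        using 1 X_H0[of y] D1[OF y] by (simp add: bounded_operator_add[OF P])
      finally show ?thesis
        using PXD[of y] D1[OF y] by simp
    qed
    then have "P z = z" for z
      using 1 oproj_in(1)[OF od] oproj_in(1)[OF od'] split[of z]
      by (simp add: oproj_swap[OF od])
    then show ?thesis
      by auto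
  qed
qed

theorem mainTheorem4:
  fixes \<Omega> :: "complex set"
    and T T0 S T1 :: "'h::complex_hilbert \<Rightarrow> 'h"
    and H0 H1 :: "'h set"
  assumes "open \<Omega>" and "connected \<Omega>"
    and "T \<in> FB2 \<Omega>"
    and "FB2_decomposition \<Omega> T H0 H1 T0 S T1"
  shows "irreducible_operator T \<and>
         (invertible_operator H1 H0 S \<longrightarrow> strongly_irreducible_operator T)"
proof -
  have "bounded_operator UNIV UNIV T"
    using assms(3) cowen_douglasD(3) unfolding FB2_def by blast
  then show ?thesis
    using FB2_irreducible FB2_strongly_irreducible assms by blast
qed

end
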